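(* Let $S=(+,+,-,-,+,+,-,-,+,+,-,-)$. Let $w_1$ be the web with boundary $S$ obtained from the coronene graph (seven hexagons: a central hexagon surrounded by six hexagons, each sharing an edge with the central one and with its two neighbours; it has 24 vertices, 12 of which have degree 2 and lie on the outer boundary) by attaching one pendant edge to each of the 12 degree-2 vertices, these pendant edges going to the endpoints $1,\dots,12$ in the cyclic order in which the degree-2 vertices occur around the outer boundary, and orienting all edges from one bipartition class to the other as forced by the boundary signs. Let $w_2$ be the web with boundary $S$ consisting of six pairwise disjoint arcs joining endpoints $2$ and $3$, $4$ and $5$, $6$ and $7$, $8$ and $9$, $10$ and $11$, and $12$ and $1$, each arc oriented from its $-$ endpoint to its $+$ endpoint. Then the invariant $[w_1]-[w_2]\in\mathrm{Inv}(V^S)$ is dual canonical.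
   Context: Quantum group and representations. Let $v$ be an indeterminate, $q^{1/2}=-v$, ground field $\mathbb{C}(v)$. $V^+$, $V^-$ are the 3-dimensional representations of $U_q(\mathfrak{sl}(3))$ with bases $e^\pm_1,e^\pm_0,e^\pm_{-1}$: on $V^+$, $E_1e^+_0=e^+_1$, $F_1e^+_1=e^+_0$, $E_2e^+_{-1}=e^+_0$, $F_2e^+_0=e^+_{-1}$, $K_1=\mathrm{diag}(q^{1/2},q^{-1/2},1)$, $K_2=\mathrm{diag}(1,q^{1/2},q^{-1/2})$; on $V^-$, $E_1e^-_{-1}=e^-_0$, $F_1e^-_0=e^-_{-1}$, $E_2e^-_0=e^-_1$, $F_2e^-_1=e^-_0$, $K_1=\mathrm{diag}(1,q^{1/2},q^{-1/2})$, $K_2=\mathrm{diag}(q^{1/2},q^{-1/2},1)$ (bases ordered $e_1,e_0,e_{-1}$, other $E_i,F_i$ on basis vectors $0$). Tensor products use $\bar\Delta(K_i^{\pm1})=K_i^{\pm1}\otimes K_i^{\pm1}$, $\bar\Delta(E_i)=E_i\otimes1+K_i^{-1}\otimes E_i$, $\bar\Delta(F_i)=F_i\otimes K_i+1\otimes F_i$; $\mathrm{Inv}(V)=\{x:E_ix=F_ix=0,K_ix=x\}$. For $S\in\{+,-\}^n$, $J\in\{-1,0,1\}^n$: $V^S=\bigotimes_k V^{s_k}$, $e^S_J=\bigotimes_k e^{s_k}_{j_k}$. Elementary tensors: $b^{+-}=e^+_1\otimes e^-_{-1}+v^{-1}e^+_0\otimes e^-_0+v^{-2}e^+_{-1}\otimes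 e^-_1$, $b^{-+}$ likewise with signs swapped; $t^{---}=e^-_1\otimes e^-_0\otimes e^-_{-1}+v^{-1}e^-_0\otimes e^-_1\otimes e^-_{-1}+v^{-1}e^-_1\otimes e^-_{-1}\otimes e^-_0+v^{-2}e^-_0\otimes e^-_{-1}\otimes e^-_1+v^{-2}e^-_{-1}\otimes e^-_1\otimes e^-_0+v^{-3}e^-_{-1}\otimes e^-_0\otimes e^-_1$, $t^{+++}$ likewise; $\sigma_{\pm\mp}(e^\pm_{-1}\otimes e^\mp_1)=1$, $\sigma_{\pm\mp}(e^\pm_0\otimes e^\mp_0)=v$, $\sigma_{\pm\mp}(e^\pm_1\otimes e^\mp_{-1})=v^2$, other pairs $0$. Webs: a web with boundary $S$ is an oriented planar graph in a disk (equivalently, in the closed lower half-plane with endpoints $1,\dots,n$ on the line $y=0$ from left to right, which corresponds to reading the disk boundary clockwise), with univalent endpoints on the boundary, other vertices trivalent and each a source or sink, the edge at endpoint $k$ pointing toward it iff $s_k=+$. Its value $[w]\in\mathrm{Inv}(V^S)$ is computed (isotopy-invariantly) after placing it in the lower half-plane and isotoping so each trivalent vertex has all edges leaving upward, reading horizontal slices bottom to top with strands labeled $+$ if pointing up and $-$ if down: a cup with legs $(a,b)$ inserts $b^{ab}$, a vertex inserts $t^{+++}$ or $t^{---}$, a cap with legs $(a,b)$ applies $\sigma_{ab}$. Dual canonical: let $\bar\Theta$ be Lusztig's quasi-R-matrix adapted to $\bar\Delta$ and $\Phi^S$ the $v$-antilinear maps with $\Phi^\pm$ fixing every $e^\pm_j$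 and $\Phi^{SS'}(x\otimes y)=\bar\Theta(\Phi^S x\otimes\Phi^{S'}y)$. By Lusztig, for each $J$ there is a unique $\Phi^S$-invariant $e^S_{\heartsuit J}\in e^S_J+\sum_{J'}v^{-1}\mathbb{Z}[v^{-1}]e^S_{J'}$; these form the dual canonical basis of $V^S$, and a vector is dual canonical if it belongs to it. *)

theory Defs
  imports "HOL-Computational_Algebra.Computational_Algebra" "HOL-Computational_Algebra.Field_as_Ring"
begin

section \<open>Ground field C(v), the bar involution, and the lattice v^{-1} Z[v^{-1}]\<close>

type_synonym K = "complex poly fract"   \<comment> \<open>the field C(v)\<close>

definition vv :: K where "vv = to_fract [:0, 1:]"   \<comment> \<open>the indeterminate v\<close>

definition qh :: K where "qh = - vv"   \<comment> \<open>q^{1/2} = -v\<close>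

text \<open>Bar involution v \<mapsto> v^{-1} (complex scalars fixed):
  p(v)/q(v) \<mapsto> p(1/v)/q(1/v) = (reflect p * v^{deg q}) / (reflect q * v^{deg p}).\<close>
definition barK :: "K \<Rightarrow> K" where
  "barK x = (case quot_of_fract x of (p, q) \<Rightarrow>
      Fract (reflect_poly p * monom 1 (degree q)) (reflect_poly q * monom 1 (degree p)))"

text \<open>The set v^{-1} Z[v^{-1}] inside C(v).\<close>
definition vinv_lattice :: "K set" where
  "vinv_lattice = {x. \<exists>p :: int poly. coeff p 0 = 0 \<and>
       x = (\<Sum>i\<le>degree p. of_int (coeff p i) * inverse vv ^ i)}"

section \<open>The representations V^S\<close>

datatype sgn = Pl | Mi   \<comment> \<open>+ and -\<close>

type_synonym vec = "int list \<Rightarrow> K"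
  \<comment> \<open>a vector of V^S is its coefficient function J \<mapsto> coefficient of e^S_J\<close>

definition valid :: "sgn list \<Rightarrow> int list \<Rightarrow> bool" where
  "valid S J \<longleftrightarrow> length J = length S \<and> set J \<subseteq> {-1, 0, 1}"

definition basis_vec :: "int list \<Rightarrow> vec" where
  "basis_vec J = (\<lambda>J'. if J' = J then 1 else 0)"   \<comment> \<open>e^S_J\<close>

datatype gen = Egen nat | Fgen nat

text \<open>Action of E_i, F_i on a single factor: tgt s g j = Some j' iff g e^s_j = e^s_{j'}.\<close>
fun tgt :: "sgn \<Rightarrow> gen \<Rightarrow> int \<Rightarrow> int option" where
  "tgt Pl (Egen i) j = (if i = 1 \<and> j = 0 then Some 1 else if i = 2 \<and> j = -1 then Some 0 else None)"
| "tgt Pl (Fgen i) j = (if i = 1 \<and> j = 1 then Some 0 else if i = 2 \<and> j = 0 then Some (-1) else None)"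
| "tgt Mi (Egen i) j = (if i = 1 \<and> j = -1 then Some 0 else if i = 2 \<and> j = 0 then Some 1 else None)"
| "tgt Mi (Fgen i) j = (if i = 1 \<and> j = 0 then Some (-1) else if i = 2 \<and> j = 1 then Some 0 else None)"

text \<open>K_i e^s_j = (q^{1/2})^{wt s i j} e^s_j.\<close>
fun wt :: "sgn \<Rightarrow> nat \<Rightarrow> int \<Rightarrow> int" where
  "wt Pl i j = (if i = 1 then (if j = 1 then 1 else if j = 0 then -1 else 0)
                else (if j = 1 then 0 else if j = 0 then 1 else -1))"
| "wt Mi i j = (if i = 1 then (if j = 1 then 0 else if j = 0 then 1 else -1)
                else (if j = 1 then 1 else if j = 0 then -1 else 0))"

text \<open>Action of E_i, F_i on V^S via the iterated coproduct \<Delta>-bar: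
  E_i acts as \<Sum>_k K_i^{-1} \<otimes> ... \<otimes> K_i^{-1} \<otimes> E_i \<otimes> 1 \<otimes> ... \<otimes> 1,
  F_i acts as \<Sum>_k 1 \<otimes> ... \<otimes> 1 \<otimes> F_i \<otimes> K_i \<otimes> ... \<otimes> K_i.\<close>
definition kfac :: "sgn list \<Rightarrow> gen \<Rightarrow> nat \<Rightarrow> int list \<Rightarrow> K" where
  "kfac S g k J = (case g of
       Egen i \<Rightarrow> (\<Prod>l<k. qh powi (- wt (S ! l) i (J ! l)))
     | Fgen i \<Rightarrow> (\<Prod>l\<in>{k<..<length S}. qh powi (wt (S ! l) i (J ! l))))"

definition gen_act :: "sgn list \<Rightarrow> gen \<Rightarrow> vec \<Rightarrow> vec" where
  "gen_act S g x = (\<lambda>J. if valid S J then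
      (\<Sum>k<length S. \<Sum>j\<in>{-1, 0, 1::int}.
          (if tgt (S ! k) g j = Some (J ! k) then kfac S g k J * x (J[k := j]) else 0))
      else 0)"

text \<open>Action of the monomial X_{i_1} X_{i_2} ... X_{i_m} (X = E or F) for the word [i_1,...,i_m].\<close>
definition word_act :: "sgn list \<Rightarrow> (nat \<Rightarrow> gen) \<Rightarrow> nat list \<Rightarrow> vec \<Rightarrow> vec" where
  "word_act S g w x = foldr (\<lambda>i y. gen_act S (g i) y) w x"

section \<open>Lusztig's quasi-R-matrix\<close>

definition cartan :: "nat \<Rightarrow> nat \<Rightarrow> int" where
  "cartan i j = (if i = j then 2 else -1)"   \<comment> \<open>i \<cdot> j for sl(3)\<close>

text \<open>Lusztig's bilinear form ( , ) on the free algebra 'f (generators \<theta>_1, \<theta>_2),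
  with Lusztig's parameter v_L = q^{1/2} (the parameter of the quantum group as given):
  (1,1) = 1, (\<theta>_i,\<theta>_i) = 1/(1 - v_L^{-2}), (x, \<theta>_i y) = (\<theta>_i,\<theta>_i) (_ir(x), y),
  where _ir is the left derivation, _ir(\<theta>_{b_1}...\<theta>_{b_n}) =
  \<Sum>_{k: b_k = i} v_L^{i \<cdot> (b_1 + ... + b_{k-1})} \<theta>_b with b_k removed.
  Words w :: nat list stand for the monomials \<theta>_w.\<close>
fun lform :: "nat list \<Rightarrow> nat list \<Rightarrow> K" where
  "lform x [] = (if x = [] then 1 else 0)"
| "lform x (i # y) = inverse (1 - inverse (qh ^ 2)) *
     (\<Sum>k<length x. if x ! k = i
        then qh powi (\<Sum>l\<leftarrow>take k x. cartan i l) * lform (take k x @ drop (Suc k) x) y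
        else 0)"

text \<open>Monomials of weight \<nu> = n1 \<alpha>_1 + n2 \<alpha>_2.\<close>
definition words :: "nat \<Rightarrow> nat \<Rightarrow> nat list set" where
  "words n1 n2 = {w. length w = n1 + n2 \<and> set w \<subseteq> {1, 2} \<and> count_list w 1 = n1}"

text \<open>A generalized inverse H of the Gram matrix G of ( , ) on the monomials of weight \<nu>
  (G H G = G).  Then \<Sum>_{w,w'} H_{w w'} \<theta>_w \<otimes> \<theta>_{w'} = \<Sum>_b b \<otimes> b^* in f_\<nu> \<otimes> f_\<nu>.\<close>
definition gram_ginv :: "nat \<Rightarrow> nat \<Rightarrow> nat list \<Rightarrow> nat list \<Rightarrow> K" where
  "gram_ginv n1 n2 = (SOME H. \<forall>a\<in>words n1 n2. \<forall>b\<in>words n1 n2.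
      (\<Sum>c\<in>words n1 n2. \<Sum>d\<in>words n1 n2. lform a c * H c d * lform d b) = lform a b)"

text \<open>Lusztig (Thm 4.1.2): \<Theta>_\<nu> = (-1)^{tr \<nu>} v_\<nu> \<Sum>_b b^- \<otimes> b^{*+}, v_\<nu> = v_L^{tr \<nu>};
  \<Theta>-bar (adapted to \<Delta>-bar) is its image under the bar involution, which fixes E_i, F_i
  and conjugates coefficients.  Coefficient of F_w \<otimes> E_{w'} in \<Theta>-bar_\<nu>:\<close>
definition thetabar_coef :: "nat \<Rightarrow> nat \<Rightarrow> nat list \<Rightarrow> nat list \<Rightarrow> K" where
  "thetabar_coef n1 n2 w w' = barK ((-1) ^ (n1 + n2) * qh ^ (n1 + n2) * gram_ginv n1 n2 w w')"

text \<open>X \<otimes> 1 and 1 \<otimes> Y on V^A \<otimes> V^B, where n = length A.\<close>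
definition op_left :: "nat \<Rightarrow> (vec \<Rightarrow> vec) \<Rightarrow> vec \<Rightarrow> vec" where
  "op_left n X z = (\<lambda>J. if n \<le> length J then X (\<lambda>J1. z (J1 @ drop n J)) (take n J) else 0)"

definition op_right :: "nat \<Rightarrow> (vec \<Rightarrow> vec) \<Rightarrow> vec \<Rightarrow> vec" where
  "op_right n Y z = (\<lambda>J. if n \<le> length J then Y (\<lambda>J2. z (take n J @ J2)) (drop n J) else 0)"

text \<open>\<Theta>-bar acting on V^A \<otimes> V^B.  Components with tr \<nu> > 2 * length A act by zero
  (F-monomials of length > 2 * length A kill V^A), so the sum is the full (finite) sum.\<close>
definition thetabar :: "sgn list \<Rightarrow> sgn list \<Rightarrow> vec \<Rightarrow> vec" where
  "thetabar A B z = (\<lambda>J. \<Sum>\<nu>\<in>{(n1, n2). n1 + n2 \<le> 2 * length A}.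
      \<Sum>w\<in>words (fst \<nu>) (snd \<nu>). \<Sum>w'\<in>words (fst \<nu>) (snd \<nu>).
        thetabar_coef (fst \<nu>) (snd \<nu>) w w' *
        op_left (length A) (word_act A Fgen w) (op_right (length A) (word_act B Egen w') z) J)"

section \<open>The antilinear maps \<Phi>^S and the dual canonical basis\<close>

text \<open>\<Phi>^\<pm> fixes every e^\<pm>_j (antilinearly); \<Phi>^{s S'}(x \<otimes> y) = \<Theta>-bar(\<Phi>^s x \<otimes> \<Phi>^{S'} y).\<close>
fun phi :: "sgn list \<Rightarrow> vec \<Rightarrow> vec" where
  "phi [] x = (\<lambda>J. if J = [] then barK (x []) else 0)"
| "phi [s] x = (\<lambda>J. if valid [s] J then barK (x J) else 0)"
| "phi (s # s' # S) x = thetabar [s] (s' # S)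
     (\<lambda>J. case J of [] \<Rightarrow> 0
        | j # J2 \<Rightarrow> if j \<in> {-1, 0, 1} then phi (s' # S) (\<lambda>J2'. x (j # J2')) J2 else 0)"

text \<open>e^S_{\<heartsuit>J}: the unique \<Phi>^S-invariant vector in e^S_J + \<Sum>_{J'} v^{-1}Z[v^{-1}] e^S_{J'}.\<close>
definition dual_can_elt :: "sgn list \<Rightarrow> int list \<Rightarrow> vec" where
  "dual_can_elt S J = (THE y. (\<forall>J'. \<not> valid S J' \<longrightarrow> y J' = 0) \<and> phi S y = y \<and>
       (\<forall>J'. y J' - basis_vec J J' \<in> vinv_lattice))"

definition dual_canonical :: "sgn list \<Rightarrow> vec \<Rightarrow> bool" where
  "dual_canonical S x \<longleftrightarrow> (\<exists>J. valid S J \<and> x = dual_can_elt S J)"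

section \<open>Webs, evaluated by horizontal slices (bottom to top)\<close>

text \<open>Cup k a b: a cup with legs (a,b) creating strands k, k+1 (k strands to its left);
  Vtx k s: a trivalent vertex with all three edges leaving upward, creating strands k..k+2,
  labelled s (Pl = source, t^{+++}; Mi = sink, t^{---});
  Cap k a b: a cap joining strands k, k+1 with labels (a,b).
  Strand labels: Pl if the strand points up, Mi if down.\<close>
datatype slice_op = Cup nat sgn sgn | Vtx nat sgn | Cap nat sgn sgn

definition cup_coef :: "int \<Rightarrow> int \<Rightarrow> K" where   \<comment> \<open>b^{+-}, b^{-+}\<close>
  "cup_coef j1 j2 = (if j1 = 1 \<and> j2 = -1 then 1 else if j1 = 0 \<and> j2 = 0 then inverse vv
     else if j1 = -1 \<and> j2 = 1 then inverse vv ^ 2 else 0)"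

definition tri_coef :: "int \<Rightarrow> int \<Rightarrow> int \<Rightarrow> K" where   \<comment> \<open>t^{+++}, t^{---}\<close>
  "tri_coef j1 j2 j3 =
     (if (j1, j2, j3) = (1, 0, -1) then 1
      else if (j1, j2, j3) = (0, 1, -1) then inverse vv
      else if (j1, j2, j3) = (1, -1, 0) then inverse vv
      else if (j1, j2, j3) = (0, -1, 1) then inverse vv ^ 2
      else if (j1, j2, j3) = (-1, 1, 0) then inverse vv ^ 2
      else if (j1, j2, j3) = (-1, 0, 1) then inverse vv ^ 3
      else 0)"

definition cap_coef :: "int \<Rightarrow> int \<Rightarrow> K" where   \<comment> \<open>\<sigma>_{+-}, \<sigma>_{-+}\<close>
  "cap_coef j1 j2 = (if j1 = -1 \<and> j2 = 1 then 1 else if j1 = 0 \<and> j2 = 0 then vv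
     else if j1 = 1 \<and> j2 = -1 then vv ^ 2 else 0)"

fun apply_op :: "slice_op \<Rightarrow> vec \<Rightarrow> vec" where
  "apply_op (Cup k a b) x = (\<lambda>J. if k + 2 \<le> length J
      then cup_coef (J ! k) (J ! (k + 1)) * x (take k J @ drop (k + 2) J) else 0)"
| "apply_op (Vtx k s) x = (\<lambda>J. if k + 3 \<le> length J
      then tri_coef (J ! k) (J ! (k + 1)) (J ! (k + 2)) * x (take k J @ drop (k + 3) J) else 0)"
| "apply_op (Cap k a b) x = (\<lambda>J. if k \<le> length J
      then (\<Sum>j1\<in>{-1, 0, 1::int}. \<Sum>j2\<in>{-1, 0, 1::int}.
              cap_coef j1 j2 * x (take k J @ [j1, j2] @ drop k J)) else 0)"

definition eval_slices :: "slice_op list \<Rightarrow> vec" where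
  "eval_slices ops = fold apply_op ops (\<lambda>J. if J = [] then 1 else 0)"

text \<open>Strand labels after a slice sequence (bookkeeping only).\<close>
fun op_labels :: "slice_op \<Rightarrow> sgn list \<Rightarrow> sgn list" where
  "op_labels (Cup k a b) L = take k L @ [a, b] @ drop k L"
| "op_labels (Vtx k s) L = take k L @ [s, s, s] @ drop k L"
| "op_labels (Cap k a b) L = take k L @ drop (k + 2) L"

section \<open>The boundary S and the webs w1 (coronene) and w2 (six arcs)\<close>

definition S12 :: "sgn list" where
  "S12 = [Pl, Pl, Mi, Mi, Pl, Pl, Mi, Mi, Pl, Pl, Mi, Mi]"

text \<open>w1: coronene with pendant edges.  Notation: inner hexagon c0..c5, spoke vertices p_i
  adjacent to c_i, outer ring p0,a01,a02,p1,a11,a12,p2,...,p5,a51,a52 (cyclically),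
  endpoints 1..12 attached to a02,a11,a12,a21,a22,...,a51,a52,a01.
  Slice presentation: cup for ring edge a01-a02 (around the bottom), cup for inner edge
  c0-c1, tripods c1,c2,c3,c4,c5,c0 and caps for the inner hexagon edges, tripods p_i
  (legs: spoke, left ring edge, right ring edge) and caps for spokes, tripods a02, a11,
  a12, ..., a52, a01 (legs: left ring edge, pendant, right ring edge) and caps for the
  ring edges.  Sources: a02,a11,a22,a31,a42,a51,p0,p2,p4,c1,c3,c5.\<close>
definition w1_slices :: "slice_op list" where
  "w1_slices =
    [Cup 0 Mi Pl, Cup 1 Mi Pl, Vtx 2 Pl, Vtx 5 Mi, Vtx 8 Pl, Vtx 11 Mi,
     Vtx 14 Pl, Vtx 17 Mi, Cap 1 Mi Pl, Cap 2 Pl Mi, Cap 3 Mi Pl, Cap 4 Pl Mi,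
     Cap 5 Mi Pl, Cap 6 Pl Mi, Cap 7 Mi Pl, Vtx 2 Mi, Cap 1 Pl Mi, Vtx 4 Pl,
     Cap 3 Mi Pl, Vtx 6 Mi, Cap 5 Pl Mi, Vtx 8 Pl, Cap 7 Mi Pl, Vtx 10 Mi,
     Cap 9 Pl Mi, Vtx 12 Pl, Cap 11 Mi Pl, Vtx 1 Pl, Cap 0 Mi Pl, Cap 1 Pl Mi,
     Vtx 2 Pl, Cap 1 Mi Pl, Vtx 3 Mi, Cap 2 Pl Mi, Cap 3 Mi Pl, Vtx 4 Mi,
     Cap 3 Pl Mi, Vtx 5 Pl, Cap 4 Mi Pl, Cap 5 Pl Mi, Vtx 6 Pl, Cap 5 Mi Pl,
     Vtx 7 Mi, Cap 6 Pl Mi, Cap 7 Mi Pl, Vtx 8 Mi, Cap 7 Pl Mi, Vtx 9 Pl,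
     Cap 8 Mi Pl, Cap 9 Pl Mi, Vtx 10 Pl, Cap 9 Mi Pl, Vtx 11 Mi, Cap 10 Pl Mi,
     Cap 11 Mi Pl, Vtx 12 Mi, Cap 11 Pl Mi, Cap 12 Mi Pl]"

text \<open>w2: arcs 12-1 (outer cup) and 2-3, 4-5, 6-7, 8-9, 10-11 (nested cups).\<close>
definition w2_slices :: "slice_op list" where
  "w2_slices = [Cup 0 Pl Mi, Cup 1 Pl Mi, Cup 3 Mi Pl, Cup 5 Pl Mi, Cup 7 Mi Pl, Cup 9 Pl Mi]"

lemma w1_boundary: "fold op_labels w1_slices [] = S12"
  by (simp add: w1_slices_def S12_def)

lemma w2_boundary: "fold op_labels w2_slices [] = S12"
  by (simp add: w2_slices_def S12_def)

definition web_w1 :: vec where "web_w1 = eval_slices w1_slices"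
definition web_w2 :: vec where "web_w2 = eval_slices w2_slices"

end

theory Submission
  imports Defs
begin

text \<open>Only \<open>\<Theta>\<close>-components of weight \<open>0, \<alpha>\<^sub>1, \<alpha>\<^sub>2, \<alpha>\<^sub>1 + \<alpha>\<^sub>2\<close> act on a three-dimensional left factor, which
  makes \<open>\<Phi>\<close> explicit as a recursion on the first tensor factor. Cups, caps and vertices commute with
  the \<open>E\<^sub>i\<close> and with \<open>\<Phi>\<close>: applied away from the first factor this is formal, and at the first factor
  it is a finite identity in the \<open>E\<close>-monomials on the remaining factors, using the Serre relation. Hence
  web vectors are \<open>\<Phi>\<close>-fixed, and a \<open>\<Phi>\<close>-fixed vector is determined by its coefficients modulo
  \<open>v\<^sup>-\<^sup>1 \<int>[v\<^sup>-\<^sup>1]\<close>. A web coefficient is a sum of powers of \<open>v\<close> over edge labellings. Sweeping around the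
  coronene sector by sector, a max-plus transfer computation shows that all exponents are at most 0
  and that exponent 0 occurs for exactly two labellings; one of them has the boundary labels of the leading term
  of \<open>w\<^sub>2\<close>, so it cancels in the difference.\<close>

section \<open>The bar involution\<close>

lemma vv_nonzero [simp]: "vv \<noteq> 0"
  by (simp add: vv_def)

lemma qh_nonzero [simp]: "qh \<noteq> 0"
  by (simp add: qh_def)

lemma to_fract_power: "to_fract (p ^ n) = to_fract p ^ n"
  by (induction n) simp_all

lemma to_fract_monom: "to_fract (monom c n) = to_fract [:c:] * vv ^ n"
proof -
  have "monom c n = [:c:] * [:0, 1:] ^ n"
    by (simp add: monom_altdef)
  then show ?thesis
    by (simp add: vv_def to_fract_power del: mult_pCons_left)
qed

text \<open>For \<open>degree p \<le> n\<close> this is \<open>v^n p(1/v)\<close>. Reversal relative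
  to a common exponent \<open>n\<close> is additive, which \<open>reflect_poly\<close> alone is
  not.\<close>

definition rev_at :: "nat \<Rightarrow> complex poly \<Rightarrow> complex poly" where
  "rev_at n p = reflect_poly p * monom 1 (n - degree p)"

lemma coeff_rev_at:
  assumes "degree p \<le> n"
  shows "coeff (rev_at n p) i = (if i \<le> n then coeff p (n - i) else 0)"
proof (cases "n - degree p \<le> i")
  case True
  have "coeff (rev_at n p) i = coeff (monom 1 (n - degree p) * reflect_poly p) i"
    by (simp add: rev_at_def mult.commute)
  also have "\<dots> = coeff (reflect_poly p) (i - (n - degree p))"
    using True by (simp add: coeff_monom_mult)
  also have "\<dots> = (if i \<le> n then coeff p (n - i) else 0)"
  proof (cases "i \<le> n")
    case i: True
    have "degree p - (i - (n - degree p)) = n - i" using i True assms by simp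
    then show ?thesis using i True assms by (simp add: coeff_reflect_poly)
  next
    case False
    then show ?thesis using assms by (simp add: coeff_reflect_poly)
  qed
  finally show ?thesis .
next
  case False
  have "coeff (rev_at n p) i = coeff (monom 1 (n - degree p) * reflect_poly p) i"
    by (simp add: rev_at_def mult.commute)
  also have "\<dots> = 0" using False by (simp add: coeff_monom_mult)
  also have "\<dots> = (if i \<le> n then coeff p (n - i) else 0)"
    using False by (simp add: coeff_eq_0)
  finally show ?thesis .
qed

lemma rev_at_add:
  assumes "degree p \<le> n" "degree r \<le> n"
  shows "rev_at n (p + r) = rev_at n p + rev_at n r"
  using assms degree_add_le[OF assms] by (intro poly_eqI) (simp add: coeff_rev_at)

lemma rev_at_nonzero: "p \<noteq> 0 \<Longrightarrow> rev_at n p \<noteq> 0"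
  by (simp add: rev_at_def monom_eq_0_iff)

text \<open>\<open>barK\<close> is defined through the normalised fraction, so independence of the
  representative comes first. It follows from \<open>a * q = p * b\<close>, since
  \<open>reflect_poly\<close> is multiplicative and the monomial factors balance by comparison of
  degrees.\<close>

lemma barK_Fract:
  assumes "q \<noteq> 0"
  shows "barK (Fract p q) = Fract (reflect_poly p * monom 1 (degree q)) (reflect_poly q * monom 1 (degree p))"
proof -
  obtain a b where ab: "quot_of_fract (Fract p q) = (a, b)" by fastforce
  have b0: "b \<noteq> 0" using ab snd_quot_of_fract_nonzero[of "Fract p q"] by simp
  have "Fract a b = Fract p q" using ab Fract_quot_of_fract[of "Fract p q"] by simp
  then have eq: "a * q = p * b" using b0 assms by (simp add: eq_fract)
  have req: "reflect_poly a * reflect_poly q = reflect_poly p * reflect_poly b"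
    using arg_cong[OF eq, of reflect_poly] by (simp add: reflect_poly_mult)
  have "(reflect_poly a * monom 1 (degree b)) * (reflect_poly q * monom 1 (degree p))
      = (reflect_poly p * monom 1 (degree q)) * (reflect_poly b * monom 1 (degree a))"
  proof (cases "p = 0")
    case True
    then have "a = 0" using eq assms by simp
    then show ?thesis using True by simp
  next
    case False
    then have a0: "a \<noteq> 0" using eq b0 by auto
    have deg: "degree a + degree q = degree p + degree b"
      using arg_cong[OF eq, of degree] a0 b0 False assms by (simp add: degree_mult_eq)
    have "monom (1::complex) (degree b) * monom 1 (degree p) = monom 1 (degree q) * monom 1 (degree a)"
      using deg by (simp add: mult_monom add.commute)
    then have "(reflect_poly a * reflect_poly q) * (monom (1::complex) (degree b) * monom 1 (degree p))
       = (reflect_poly p * reflect_poly b) * (monom 1 (degree q) * monom 1 (degree a))"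
      using req by simp
    then show ?thesis by (simp only: mult_ac)
  qed
  then show ?thesis
    using ab b0 assms by (simp add: barK_def eq_fract monom_eq_0_iff)
qed

lemma barK_Fract_rev_at:
  assumes "q \<noteq> 0" "degree p \<le> n" "degree q \<le> n"
  shows "barK (Fract p q) = Fract (rev_at n p) (rev_at n q)"
proof -
  have "monom (1::complex) (degree q) * monom 1 (n - degree q) = monom 1 (degree p) * monom 1 (n - degree p)"
    using assms by (simp add: mult_monom)
  then have "(reflect_poly p * reflect_poly q) * (monom (1::complex) (degree q) * monom 1 (n - degree q))
     = (reflect_poly p * reflect_poly q) * (monom 1 (degree p) * monom 1 (n - degree p))"
    by simp
  then have "(reflect_poly p * monom 1 (degree q)) * rev_at n q
     = rev_at n p * (reflect_poly q * monom 1 (degree p))"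
    unfolding rev_at_def by (simp only: mult_ac)
  then show ?thesis
    using assms(1) rev_at_nonzero[OF assms(1), of n]
    by (simp add: barK_Fract eq_fract monom_eq_0_iff)
qed

lemma barK_add: "barK (x + y) = barK x + barK y"
proof -
  obtain p q where x: "x = Fract p q" "q \<noteq> 0" by (cases x) auto
  obtain r s where y: "y = Fract r s" "s \<noteq> 0" by (cases y) auto
  \<comment> \<open>A common denominator, and an exponent bounding its degree and those of both
    numerators, bring all three fractions under \<open>barK_Fract_rev_at\<close>.\<close>
  define d n where "d = q * s" and "n = degree (p * s) + degree (r * q) + degree d"
  have d0: "d \<noteq> 0" using x y by (simp add: d_def)
  have x': "x = Fract (p * s) d" and y': "y = Fract (r * q) d"
    using x y by (simp_all add: d_def eq_fract)
  have xy: "x + y = Fract (p * s + r * q) d"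
    using x y by (simp add: d_def)
  have "degree (p * s + r * q) \<le> n"
    by (rule degree_add_le) (simp_all add: n_def)
  then have "barK (x + y) = Fract (rev_at n (p * s + r * q)) (rev_at n d)"
    unfolding xy by (intro barK_Fract_rev_at) (simp_all add: d0 n_def)
  also have "\<dots> = Fract (rev_at n (p * s)) (rev_at n d) + Fract (rev_at n (r * q)) (rev_at n d)"
    using rev_at_nonzero[OF d0, of n] by (simp add: rev_at_add n_def eq_fract algebra_simps)
  also have "Fract (rev_at n (p * s)) (rev_at n d) = barK x"
    unfolding x' by (intro barK_Fract_rev_at[symmetric]) (simp_all add: d0 n_def)
  also have "Fract (rev_at n (r * q)) (rev_at n d) = barK y"
    unfolding y' by (intro barK_Fract_rev_at[symmetric]) (simp_all add: d0 n_def)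
  finally show ?thesis .
qed

lemma barK_0 [simp]: "barK 0 = 0"
  using barK_Fract[of 1 0] by (simp add: fract_collapse)

lemma barK_1 [simp]: "barK 1 = 1"
  using barK_Fract[of 1 1] by (simp add: fract_collapse)

lemma monom_add: "monom (1 :: 'a :: comm_semiring_1) (m + n) = monom 1 m * monom 1 n"
  by (simp add: mult_monom)

lemma barK_mult: "barK (x * y) = barK x * barK y"
proof -
  obtain p q where x: "x = Fract p q" "q \<noteq> 0" by (cases x) auto
  obtain r s where y: "y = Fract r s" "s \<noteq> 0" by (cases y) auto
  show ?thesis
  proof (cases "p = 0 \<or> r = 0")
    case True
    then have "x = 0 \<or> y = 0" using x y by (auto simp: fract_collapse)
    then show ?thesis by auto
  next
    case False
    then have deg: "degree (p * r) = degree p + degree r" "degree (q * s) = degree q + degree s"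
      using x y by (auto simp: degree_mult_eq)
    have "barK (x * y) = Fract (reflect_poly (p * r) * monom 1 (degree (q * s)))
        (reflect_poly (q * s) * monom 1 (degree (p * r)))"
      using x y by (simp add: barK_Fract)
    also have "\<dots> = Fract ((reflect_poly p * monom 1 (degree q)) * (reflect_poly r * monom 1 (degree s)))
        ((reflect_poly q * monom 1 (degree p)) * (reflect_poly s * monom 1 (degree r)))"
      by (simp add: reflect_poly_mult deg mult_ac monom_add)
    also have "\<dots> = barK x * barK y"
      using x y by (simp add: barK_Fract)
    finally show ?thesis .
  qed
qed

lemma barK_uminus: "barK (- x) = - barK x"
  using barK_add[of x "- x"] by (simp add: eq_neg_iff_add_eq_0 add.commute)

lemma barK_diff: "barK (x - y) = barK x - barK y"
  using barK_add[of x "- y"] by (simp add: barK_uminus)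

lemma barK_inverse: "barK (inverse x) = inverse (barK x)"
proof (cases "x = 0")
  case False
  then have "barK x * barK (inverse x) = 1"
    by (simp add: barK_mult[symmetric])
  then show ?thesis by (metis inverse_unique)
qed simp

lemma barK_power: "barK (x ^ n) = barK x ^ n"
  by (induction n) (simp_all add: barK_mult)

lemma barK_sum: "barK (sum f A) = (\<Sum>a\<in>A. barK (f a))"
  by (induction A rule: infinite_finite_induct) (simp_all add: barK_add)

lemma barK_of_nat: "barK (of_nat n) = of_nat n"
  by (induction n) (simp_all add: barK_add)

lemma barK_of_int: "barK (of_int n) = of_int n"
  by (cases n) (simp_all add: barK_of_nat barK_uminus barK_diff)

lemma barK_vv: "barK vv = inverse vv"
proof -
  have "vv = Fract [:0, 1:] 1" by (simp add: vv_def to_fract_def)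
  then have "barK vv = barK (Fract [:0, 1:] 1)" by (rule arg_cong)
  also have "\<dots> = Fract 1 [:0, 1:]"
    by (simp add: barK_Fract monom_Suc reflect_poly_def one_pCons)
  finally have "barK vv = Fract 1 [:0, 1:]" .
  moreover have "Fract 1 [:0, 1:] * vv = 1"
    by (simp add: vv_def to_fract_def eq_fract One_fract_def)
  ultimately show ?thesis
    by (metis inverse_unique mult.commute)
qed

lemma barK_qh: "barK qh = inverse qh"
  by (simp add: qh_def barK_uminus barK_vv)

lemmas barK_simps = barK_add barK_mult barK_uminus barK_diff barK_inverse barK_power barK_vv barK_qh

section \<open>The lattice \<open>v^{-1} Z[v^{-1}]\<close> and its bar-fixed elements\<close>

lemma vinv_latticeI:
  assumes "c 0 = 0" and "x = (\<Sum>i\<le>n. of_int (c i) * inverse vv ^ i)"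
  shows "x \<in> vinv_lattice"
proof -
  define p :: "int poly" where "p = (\<Sum>i\<le>n. monom (c i) i)"
  have coeff: "coeff p i = (if i \<le> n then c i else 0)" for i
    by (simp add: p_def coeff_sum)
  have "degree p \<le> n" by (rule degree_le) (simp add: coeff)
  then have "(\<Sum>i\<le>degree p. of_int (coeff p i) * inverse vv ^ i) = (\<Sum>i\<le>n. of_int (coeff p i) * inverse vv ^ i)"
    by (intro sum.mono_neutral_left) (auto simp: coeff_eq_0)
  also have "\<dots> = x" using assms by (simp add: coeff)
  finally show ?thesis
    using assms by (auto simp: vinv_lattice_def coeff intro!: exI[of _ p])
qed

text \<open>Stated for all large \<open>n\<close>, so that two lattice elements can be written over
  the same summation range.\<close>

lemma vinv_latticeE:
  assumes "x \<in> vinv_lattice"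
  shows "\<exists>c N. c 0 = 0 \<and> (\<forall>n\<ge>N. x = (\<Sum>i\<le>n. of_int (c i) * inverse vv ^ i))"
proof -
  obtain p :: "int poly" where p: "coeff p 0 = 0"
    "x = (\<Sum>i\<le>degree p. of_int (coeff p i) * inverse vv ^ i)"
    using assms by (auto simp: vinv_lattice_def)
  have "x = (\<Sum>i\<le>n. of_int (coeff p i) * inverse vv ^ i)" if "degree p \<le> n" for n
    unfolding p(2) using that by (intro sum.mono_neutral_left) (auto simp: coeff_eq_0)
  then show ?thesis using p(1) by blast
qed

lemma vinv_lattice_0: "0 \<in> vinv_lattice"
  by (rule vinv_latticeI[of "\<lambda>_. 0" _ 0]) simp_all

lemma vinv_lattice_add:
  assumes "x \<in> vinv_lattice" "y \<in> vinv_lattice"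
  shows "x + y \<in> vinv_lattice"
proof -
  obtain c N where c: "c 0 = 0" "\<And>n. N \<le> n \<Longrightarrow> x = (\<Sum>i\<le>n. of_int (c i) * inverse vv ^ i)"
    using vinv_latticeE[OF assms(1)] by blast
  obtain d M where d: "d 0 = 0" "\<And>n. M \<le> n \<Longrightarrow> y = (\<Sum>i\<le>n. of_int (d i) * inverse vv ^ i)"
    using vinv_latticeE[OF assms(2)] by blast
  show ?thesis
    by (rule vinv_latticeI[of "\<lambda>i. c i + d i" _ "N + M"])
      (simp_all add: c(1) d(1) c(2)[of "N + M"] d(2)[of "N + M"] algebra_simps sum.distrib)
qed

lemma vinv_lattice_uminus:
  assumes "x \<in> vinv_lattice"
  shows "- x \<in> vinv_lattice"
proof -
  obtain c N where c: "c 0 = 0" "\<And>n. N \<le> n \<Longrightarrow> x = (\<Sum>i\<le>n. of_int (c i) * inverse vv ^ i)"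
    using vinv_latticeE[OF assms(1)] by blast
  show ?thesis
    by (rule vinv_latticeI[of "\<lambda>i. - c i" _ N]) (simp_all add: c(1) c(2)[of N] sum_negf)
qed

lemma vinv_lattice_diff:
  "x \<in> vinv_lattice \<Longrightarrow> y \<in> vinv_lattice \<Longrightarrow> x - y \<in> vinv_lattice"
  using vinv_lattice_add[of x "- y"] vinv_lattice_uminus[of y] by simp

lemma vinv_lattice_inverse_power: "n > 0 \<Longrightarrow> inverse vv ^ n \<in> vinv_lattice"
  by (rule vinv_latticeI[of "\<lambda>i. if i = n then 1 else 0" _ n])
    (auto simp: if_distrib[of of_int] if_distrib[of "\<lambda>y. y * _"] cong: if_cong)

lemma vinv_lattice_powi: "e < 0 \<Longrightarrow> vv powi e \<in> vinv_lattice"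
  using vinv_lattice_inverse_power[of "nat (- e)"] by (simp add: power_int_def)

lemma to_fract_of_nat: "to_fract (of_nat n) = of_nat n"
  by (induction n) simp_all

lemma to_fract_of_int: "to_fract (of_int k) = of_int k"
  by (cases k) (simp_all add: to_fract_of_nat del: of_nat_Suc)

text \<open>After multiplication by \<open>v^n\<close>, \<open>x\<close> has exponents at most
  \<open>n\<close> and \<open>barK x\<close> exponents at least \<open>n\<close>. Comparing
  coefficients at \<open>n + j\<close> kills each \<open>c j\<close> with \<open>j > 0\<close>;
  \<open>c 0\<close> vanishes by membership in the lattice.\<close>

lemma vinv_lattice_bar_fixed:
  assumes "x \<in> vinv_lattice" "barK x = x"
  shows "x = 0"
proof -
  obtain c n where c: "c 0 = 0" "x = (\<Sum>i\<le>n. of_int (c i) * inverse vv ^ i)"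
    using vinv_latticeE[OF assms(1)] by blast
  define A B :: "complex poly" where
    "A = (\<Sum>i\<le>n. monom (of_int (c i)) (n - i))" and "B = (\<Sum>i\<le>n. monom (of_int (c i)) (n + i))"
  have int: "to_fract [:of_int k:] = (of_int k :: K)" for k
    using to_fract_of_int[where 'a = "complex poly", of k] by (simp only: of_int_poly)
  have "x * vv ^ n = (\<Sum>i\<le>n. of_int (c i) * (inverse vv ^ i * vv ^ n))"
    unfolding c(2) sum_distrib_right by (simp add: mult_ac)
  also have "\<dots> = (\<Sum>i\<le>n. of_int (c i) * vv ^ (n - i))"
    by (intro sum.cong refl) (simp add: power_diff field_simps)
  also have "\<dots> = to_fract A"
    by (simp add: A_def to_fract_sum to_fract_monom int)
  finally have A: "x * vv ^ n = to_fract A" .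
  have "barK x = (\<Sum>i\<le>n. of_int (c i) * vv ^ i)"
    unfolding c(2) by (simp add: barK_sum barK_mult barK_of_int barK_power barK_inverse barK_vv)
  then have "barK x * vv ^ n = (\<Sum>i\<le>n. of_int (c i) * vv ^ (n + i))"
    by (simp add: sum_distrib_left power_add mult_ac)
  also have "\<dots> = to_fract B"
    by (simp add: B_def to_fract_sum to_fract_monom int)
  finally have "A = B" using A assms(2) by simp
  have "of_int (c j) = (0::complex)" if "j \<le> n" for j
  proof (cases "j = 0")
    case False
    have "coeff B (n + j) = (\<Sum>i\<le>n. if i = j then of_int (c i) else 0)"
      unfolding B_def coeff_sum by (intro sum.cong refl) auto
    also have "\<dots> = of_int (c j)"
      using that by simp
    finally have "of_int (c j) = coeff A (n + j)"
      using \<open>A = B\<close> by simp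
    also have "\<dots> = 0"
      unfolding A_def coeff_sum by (intro sum.neutral ballI) (use False in auto)
    finally show ?thesis .
  qed (simp add: c(1))
  then show ?thesis unfolding c(2) by simp
qed

section \<open>Vectors split off along the first factor\<close>

text \<open>A \<open>vec\<close> is a function on all integer lists, so lying in \<open>V^S\<close>
  has to be a separate predicate.\<close>

definition supp :: "sgn list \<Rightarrow> vec \<Rightarrow> bool" where
  "supp S x \<longleftrightarrow> (\<forall>J. \<not> valid S J \<longrightarrow> x J = 0)"

definition vzero :: vec where "vzero = (\<lambda>J. 0)"
definition vadd :: "vec \<Rightarrow> vec \<Rightarrow> vec" where "vadd x y = (\<lambda>J. x J + y J)"
definition vscale :: "K \<Rightarrow> vec \<Rightarrow> vec" where "vscale c x = (\<lambda>J. c * x J)"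

text \<open>The vector \<open>e\<^sub>1 \<otimes> x + e\<^sub>0 \<otimes> y + e\<^sub>-\<^sub>1 \<otimes> z\<close>.\<close>
definition tri :: "vec \<Rightarrow> vec \<Rightarrow> vec \<Rightarrow> vec" where
  "tri x y z = (\<lambda>J. case J of [] \<Rightarrow> 0 | j # J' \<Rightarrow>
     if j = 1 then x J' else if j = 0 then y J' else if j = -1 then z J' else 0)"

lemmas vec_defs = vzero_def vadd_def vscale_def

lemma tri_Nil [simp]: "tri x y z [] = 0"
  by (simp add: tri_def)

lemma tri_Cons: "tri x y z (j # J) =
    (if j = 1 then x J else if j = 0 then y J else if j = -1 then z J else 0)"
  by (simp add: tri_def)

lemma tri_slices [simp]:
  "(\<lambda>J. tri x y z (1 # J)) = x" "(\<lambda>J. tri x y z (0 # J)) = y" "(\<lambda>J. tri x y z (-1 # J)) = z"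
  by (simp_all add: tri_Cons)

lemma tri_eq_iff [simp]: "tri x y z = tri x' y' z' \<longleftrightarrow> x = x' \<and> y = y' \<and> z = z'"
  by (metis tri_slices)

lemma valid_Nil [simp]: "valid [] J \<longleftrightarrow> J = []" "\<not> valid (s # S) []"
  by (auto simp: valid_def)

lemma valid_Cons [simp]: "valid (s # S) (j # J) \<longleftrightarrow> (j = 1 \<or> j = 0 \<or> j = -1) \<and> valid S J"
  by (auto simp: valid_def)

lemma supp_tri [simp]: "supp (s # S) (tri x y z) \<longleftrightarrow> supp S x \<and> supp S y \<and> supp S z"
proof
  assume *: "supp (s # S) (tri x y z)"
  show "supp S x \<and> supp S y \<and> supp S z"
    unfolding supp_def
  proof (intro conjI allI impI)
    fix J assume "\<not> valid S J"
    then have "tri x y z (j # J) = 0" for j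
      using * by (simp add: supp_def)
    from this[of 1] this[of 0] this[of "-1"] show "x J = 0" "y J = 0" "z J = 0"
      by (simp_all add: tri_Cons)
  qed
next
  assume "supp S x \<and> supp S y \<and> supp S z"
  then show "supp (s # S) (tri x y z)"
    unfolding supp_def by (auto simp: tri_def split: list.split)
qed

lemma supp_ConsE:
  assumes "supp (s # S) x"
  obtains x1 x0 xm where "x = tri x1 x0 xm" "supp S x1" "supp S x0" "supp S xm"
proof -
  have "x J = tri (\<lambda>J. x (1 # J)) (\<lambda>J. x (0 # J)) (\<lambda>J. x (-1 # J)) J" for J
  proof (cases J)
    case Nil
    then show ?thesis using assms by (simp add: supp_def)
  next
    case (Cons j J')
    then show ?thesis
      using assms by (auto simp: supp_def tri_Cons)
  qed
  then have "x = tri (\<lambda>J. x (1 # J)) (\<lambda>J. x (0 # J)) (\<lambda>J. x (-1 # J))" ..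
  with that assms show ?thesis by (metis supp_tri)
qed

lemma supp_vec [simp]:
  "supp S vzero" "supp S x \<Longrightarrow> supp S y \<Longrightarrow> supp S (vadd x y)" "supp S x \<Longrightarrow> supp S (vscale c x)"
  by (auto simp: supp_def vec_defs)

lemma supp_gen_act [simp]: "supp S (gen_act S g x)"
  by (auto simp: supp_def gen_act_def)

lemma vadd_tri [simp]: "vadd (tri x y z) (tri x' y' z') = tri (vadd x x') (vadd y y') (vadd z z')"
  by (auto simp: fun_eq_iff vadd_def tri_def split: list.split)

lemma vscale_tri [simp]: "vscale c (tri x y z) = tri (vscale c x) (vscale c y) (vscale c z)"
  by (auto simp: fun_eq_iff vscale_def tri_def split: list.split)

lemma vzero_tri [simp]: "tri vzero vzero vzero = vzero"
  by (auto simp: fun_eq_iff vzero_def tri_def split: list.split)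

lemma gen_act_vadd [simp]: "gen_act S g (vadd x y) = vadd (gen_act S g x) (gen_act S g y)"
proof -
  have "(if P then c * (x J + y J) else 0) = (if P then c * x J else 0) + (if P then c * y J else 0)"
    for P c J by (simp add: algebra_simps)
  then show ?thesis
    by (simp add: gen_act_def vadd_def sum.distrib fun_eq_iff del: sum.insert)
qed

lemma gen_act_vscale [simp]: "gen_act S g (vscale c x) = vscale c (gen_act S g x)"
proof -
  have "(if P then d * (c * x J) else 0) = c * (if P then d * x J else 0)" for P d J
    by simp
  then show ?thesis
    by (simp add: gen_act_def vscale_def sum_distrib_left fun_eq_iff del: sum.insert)
qed

lemma gen_act_vzero [simp]: "gen_act S g vzero = vzero"
  using gen_act_vscale[of S g 0 vzero] by (simp add: vscale_def vzero_def)

lemma gen_act_Nil [simp]: "gen_act [] g x = vzero"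
  by (rule ext) (simp add: gen_act_def vzero_def)

text \<open>The coproduct \<open>E \<otimes> 1 + K^{-1} \<otimes> E\<close> with the first tensor
  factor split off.\<close>

lemma gen_act_E_Cons: "gen_act (s # S) (Egen i) x = (\<lambda>J. case J of [] \<Rightarrow> 0 | j # J' \<Rightarrow>
   if valid (s # S) J then
     (\<Sum>j'\<in>{-1, 0, 1}. if tgt s (Egen i) j' = Some j then x (j' # J') else 0) +
     qh powi (- wt s i j) * gen_act S (Egen i) (\<lambda>J. x (j # J)) J'
   else 0)"
proof
  fix J
  show "gen_act (s # S) (Egen i) x J = (case J of [] \<Rightarrow> 0 | j # J' \<Rightarrow>
   if valid (s # S) J then
     (\<Sum>j'\<in>{-1, 0, 1}. if tgt s (Egen i) j' = Some j then x (j' # J') else 0) +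
     qh powi (- wt s i j) * gen_act S (Egen i) (\<lambda>J. x (j # J)) J'
   else 0)"
  proof (cases J)
    case Nil
    then show ?thesis by (simp add: gen_act_def)
  next
    case (Cons j J')
    show ?thesis
    proof (cases "valid (s # S) (j # J')")
      case True
      have 0: "kfac (s # S) (Egen i) 0 (j # J') = 1"
        by (simp add: kfac_def)
      have Suc: "kfac (s # S) (Egen i) (Suc k) (j # J') = qh powi (- wt s i j) * kfac S (Egen i) k J'" for k
        by (simp add: kfac_def prod.lessThan_Suc_shift del: prod.lessThan_Suc)
      have "gen_act (s # S) (Egen i) x J =
         (\<Sum>j'\<in>{-1, 0, 1}. if tgt s (Egen i) j' = Some j then x (j' # J') else 0) +
         (\<Sum>k<length S. \<Sum>j'\<in>{-1, 0, 1}. if tgt (S ! k) (Egen i) j' = Some (J' ! k)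
            then qh powi (- wt s i j) * kfac S (Egen i) k J' * x (j # J'[k := j']) else 0)"
        using True Cons
        by (simp add: gen_act_def sum.lessThan_Suc_shift 0 Suc del: sum.lessThan_Suc tgt.simps wt.simps cong: if_cong)
      also have "(\<Sum>k<length S. \<Sum>j'\<in>{-1, 0, 1}. if tgt (S ! k) (Egen i) j' = Some (J' ! k)
            then qh powi (- wt s i j) * kfac S (Egen i) k J' * x (j # J'[k := j']) else 0) =
         qh powi (- wt s i j) * gen_act S (Egen i) (\<lambda>J. x (j # J)) J'"
        using True
        by (simp only: gen_act_def valid_Cons if_True sum_distrib_left)
          (intro sum.cong refl, simp add: mult_ac)
      finally show ?thesis using True Cons by simp
    next
      case False
      then show ?thesis using Cons by (simp add: gen_act_def del: valid_Cons)
    qed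
  qed
qed

text \<open>\<open>E\<^sub>h\<^sub>i\<close> maps \<open>e\<^sub>0\<close> to \<open>e\<^sub>1\<close> and \<open>E\<^sub>l\<^sub>o\<close> maps \<open>e\<^sub>-\<^sub>1\<close> to \<open>e\<^sub>0\<close>; the two representations differ only by exchanging
  the indices 1 and 2.\<close>
fun hi :: "sgn \<Rightarrow> nat" where "hi Pl = 1" | "hi Mi = 2"
fun lo :: "sgn \<Rightarrow> nat" where "lo Pl = 2" | "lo Mi = 1"

abbreviation Ehi :: "sgn \<Rightarrow> sgn list \<Rightarrow> vec \<Rightarrow> vec" where "Ehi s S \<equiv> gen_act S (Egen (hi s))"
abbreviation Elo :: "sgn \<Rightarrow> sgn list \<Rightarrow> vec \<Rightarrow> vec" where "Elo s S \<equiv> gen_act S (Egen (lo s))"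

text \<open>The operator \<open>K^{-1}\<close> for \<open>hi s\<close> scales \<open>e_1\<close>,
  \<open>e_0\<close>, \<open>e_{-1}\<close> by \<open>inverse qh\<close>, \<open>qh\<close>,
  \<open>1\<close>. The summand \<open>y\<close> stands outside any inner \<open>gen_act\<close>,
  while the left side truncates to valid indices; hence the support assumption.\<close>

lemma Ehi_tri:
  assumes "supp S y"
  shows "Ehi s (s # S) (tri x y z) =
    tri (vadd y (vscale (inverse qh) (Ehi s S x))) (vscale qh (Ehi s S y)) (Ehi s S z)"
proof
  fix J
  show "Ehi s (s # S) (tri x y z) J =
    tri (vadd y (vscale (inverse qh) (Ehi s S x))) (vscale qh (Ehi s S y)) (Ehi s S z) J"
    using assms supp_gen_act[of S]
    by (cases J; cases s) (auto simp: gen_act_E_Cons tri_Cons vec_defs supp_def power_int_minus)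
qed

lemma Elo_tri:
  assumes "supp S z"
  shows "Elo s (s # S) (tri x y z) =
    tri (Elo s S x) (vadd z (vscale (inverse qh) (Elo s S y))) (vscale qh (Elo s S z))"
proof
  fix J
  show "Elo s (s # S) (tri x y z) J =
    tri (Elo s S x) (vadd z (vscale (inverse qh) (Elo s S y))) (vscale qh (Elo s S z)) J"
    using assms supp_gen_act[of S]
    by (cases J; cases s) (auto simp: gen_act_E_Cons tri_Cons vec_defs supp_def power_int_minus)
qed

section \<open>The quasi-R-matrix on a three-dimensional factor\<close>

lemma words_0_0: "words 0 0 = {[]}" and words_1_0: "words 1 0 = {[1]}" and words_0_1: "words 0 1 = {[2]}"
  and words_2_0: "words 2 0 = {[1, 1]}" and words_0_2: "words 0 2 = {[2, 2]}"
  and words_1_1: "words 1 1 = {[1, 2], [2, 1]}"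
  by (auto simp: words_def length_Suc_conv numeral_2_eq_2 split: if_splits)

lemma qh_square_neq_1: "1 - inverse (qh ^ 2) \<noteq> 0"
proof
  assume "1 - inverse (qh ^ 2) = 0"
  then have "vv ^ 2 = 1" by (simp add: qh_def field_simps)
  then have "to_fract (monom (1::complex) 2) = to_fract 1"
    by (simp add: to_fract_monom flip: one_pCons)
  then show False
    by (simp only: to_fract_eq_iff monom_eq_1_iff) simp
qed

lemma thetabar_coef_0_0: "thetabar_coef 0 0 [] [] = 1"
proof -
  have "\<exists>H. \<forall>a\<in>words 0 0. \<forall>b\<in>words 0 0.
      (\<Sum>c\<in>words 0 0. \<Sum>d\<in>words 0 0. lform a c * H c d * lform d b) = lform a b"
    by (rule exI[of _ "\<lambda>_ _. 1"]) (simp add: words_0_0)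
  from someI_ex[OF this, folded gram_ginv_def] show ?thesis
    by (simp add: thetabar_coef_def words_0_0)
qed

definition theta_a :: K where "theta_a = qh - inverse qh"

text \<open>For a weight with a single word, \<open>G H G = G\<close> with
  \<open>G = c \<noteq> 0\<close> forces \<open>H = inverse c\<close>. So the choice in
  \<open>gram_ginv\<close> has a known value once a witness shows that the equation is
  solvable.\<close>

lemma thetabar_coef_single:
  assumes "words m n = {[i]}" and "m + n = 1"
  shows "thetabar_coef m n [i] [i] = theta_a"
proof -
  define c where "c = inverse (1 - inverse (qh ^ 2))"
  have c: "c \<noteq> 0" using qh_square_neq_1 by (simp add: c_def)
  have form: "lform [i] [i] = c" by (simp add: c_def)
  have "\<exists>H. \<forall>a\<in>words m n. \<forall>b\<in>words m n.
      (\<Sum>c\<in>words m n. \<Sum>d\<in>words m n. lform a c * H c d * lform d b) = lform a b"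
    using c by (intro exI[of _ "\<lambda>_ _. inverse c"]) (simp add: assms form del: lform.simps)
  from someI_ex[OF this, folded gram_ginv_def] have "c * gram_ginv m n [i] [i] * c = c"
    by (simp add: assms form del: lform.simps)
  then have "gram_ginv m n [i] [i] = inverse c"
    using c by (simp add: field_simps)
  then have ginv: "gram_ginv m n [i] [i] = 1 - inverse (qh ^ 2)"
    by (simp add: c_def)
  then show ?thesis
    unfolding thetabar_coef_def ginv assms(2) theta_a_def
    by (simp add: barK_simps) (simp add: field_simps power2_eq_square)
qed

text \<open>The equation \<open>G H G = G\<close> for \<open>G = r\<^sup>2 (1, p; p, 1)\<close>, solved by multiplying with the adjugate on both sides.\<close>
lemma gram_inverse_2:
  fixes r p :: "'a :: field"
  assumes r: "r * (1 - p ^ 2) = 1"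
  shows
    "(r ^ 2 * h11 * r ^ 2 + r ^ 2 * h12 * (r ^ 2 * p) +
        (r ^ 2 * p * h21 * r ^ 2 + r ^ 2 * p * h22 * (r ^ 2 * p)) = r ^ 2 \<and>
      r ^ 2 * h11 * (r ^ 2 * p) + r ^ 2 * h12 * r ^ 2 +
        (r ^ 2 * p * h21 * (r ^ 2 * p) + r ^ 2 * p * h22 * r ^ 2) = r ^ 2 * p \<and>
      r ^ 2 * p * h11 * r ^ 2 + r ^ 2 * p * h12 * (r ^ 2 * p) +
        (r ^ 2 * h21 * r ^ 2 + r ^ 2 * h22 * (r ^ 2 * p)) = r ^ 2 * p \<and>
      r ^ 2 * p * h11 * (r ^ 2 * p) + r ^ 2 * p * h12 * r ^ 2 +
        (r ^ 2 * h21 * (r ^ 2 * p) + r ^ 2 * h22 * r ^ 2) = r ^ 2) \<longleftrightarrow>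
     (h11 = 1 - p ^ 2 \<and> h22 = 1 - p ^ 2 \<and> h12 = - p * (1 - p ^ 2) \<and> h21 = - p * (1 - p ^ 2))"
    (is "(?e11 = _ \<and> ?e12 = _ \<and> ?e21 = _ \<and> ?e22 = _) \<longleftrightarrow> ?R")
proof
  define w where "w = 1 - p ^ 2"
  have rw: "r ^ 2 * w ^ 2 = 1" using r by (simp add: w_def power_mult_distrib[symmetric])
  then have r0: "r ^ 2 \<noteq> 0" by auto
  have cancel: "h = k * w" if "r ^ 4 * w ^ 2 * h = r ^ 2 * w * k" for h k
  proof -
    have "r ^ 2 * h = r ^ 2 * (r ^ 2 * w ^ 2) * h" using rw by simp
    also have "\<dots> = r ^ 2 * (k * w)" using that by (simp add: algebra_simps flip: power_add)
    finally show ?thesis using r0 by simp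
  qed
  assume "?e11 = r ^ 2 \<and> ?e12 = r ^ 2 * p \<and> ?e21 = r ^ 2 * p \<and> ?e22 = r ^ 2"
  then have L: "?e11 = r ^ 2" "?e12 = r ^ 2 * p" "?e21 = r ^ 2 * p" "?e22 = r ^ 2" by auto
  have "r ^ 4 * w ^ 2 * h11 = ?e11 - p * ?e12 - p * ?e21 + p ^ 2 * ?e22"
    unfolding w_def by algebra
  also have "\<dots> = r ^ 2 * w * 1"
    unfolding L w_def by algebra
  finally have h11: "h11 = 1 * w" by (rule cancel)
  have "r ^ 4 * w ^ 2 * h12 = ?e12 - p * ?e11 - p * ?e22 + p ^ 2 * ?e21"
    unfolding w_def by algebra
  also have "\<dots> = r ^ 2 * w * (- p)"
    unfolding L w_def by algebra
  finally have h12: "h12 = (- p) * w" by (rule cancel)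
  have "r ^ 4 * w ^ 2 * h21 = ?e21 - p * ?e11 - p * ?e22 + p ^ 2 * ?e12"
    unfolding w_def by algebra
  also have "\<dots> = r ^ 2 * w * (- p)"
    unfolding L w_def by algebra
  finally have h21: "h21 = (- p) * w" by (rule cancel)
  have "r ^ 4 * w ^ 2 * h22 = ?e22 - p * ?e12 - p * ?e21 + p ^ 2 * ?e11"
    unfolding w_def by algebra
  also have "\<dots> = r ^ 2 * w * 1"
    unfolding L w_def by algebra
  finally have h22: "h22 = 1 * w" by (rule cancel)
  show ?R using h11 h12 h21 h22 by (simp add: w_def)
next
  define w where "w = 1 - p ^ 2"
  have rw: "r ^ 2 * w ^ 2 = 1" using r by (simp add: w_def power_mult_distrib[symmetric])
  have *: "r ^ 4 * w ^ 2 * x = r ^ 2 * x" for x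
    using arg_cong[OF rw, of "\<lambda>y. r ^ 2 * y * x"] by (simp add: algebra_simps flip: power_add)
  assume ?R
  then have h: "h11 = w" "h22 = w" "h12 = - p * w" "h21 = - p * w" by (simp_all add: w_def)
  have "?e11 = r ^ 4 * w ^ 2 * 1" "?e12 = r ^ 4 * w ^ 2 * p" "?e21 = r ^ 4 * w ^ 2 * p" "?e22 = r ^ 4 * w ^ 2 * 1"
    unfolding h w_def by algebra+
  then show "?e11 = r ^ 2 \<and> ?e12 = r ^ 2 * p \<and> ?e21 = r ^ 2 * p \<and> ?e22 = r ^ 2"
    unfolding * by simp
qed

text \<open>In weight \<open>\<alpha>\<^sub>1 + \<alpha>\<^sub>2\<close> the Gram matrix is invertible, so its generalized inverse is unique.\<close>
lemma thetabar_coef_1_1: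
  "thetabar_coef 1 1 [1, 2] [1, 2] = inverse (qh ^ 2) - 1"
  "thetabar_coef 1 1 [2, 1] [2, 1] = inverse (qh ^ 2) - 1"
  "thetabar_coef 1 1 [1, 2] [2, 1] = theta_a"
  "thetabar_coef 1 1 [2, 1] [1, 2] = theta_a"
proof -
  define p r where "p = inverse qh" and "r = inverse (1 - p ^ 2)"
  have r: "r \<noteq> 0" "r * (1 - p ^ 2) = 1" "1 - p ^ 2 \<noteq> 0"
    using qh_square_neq_1 by (simp_all add: r_def p_def power_inverse)
  have form: "lform [1, 2] [1, 2] = r ^ 2" "lform [2, 1] [2, 1] = r ^ 2"
    "lform [1, 2] [2, 1] = r ^ 2 * p" "lform [2, 1] [1, 2] = r ^ 2 * p"
    by (simp_all add: r_def p_def cartan_def power_int_minus power2_eq_square sum.lessThan_Suc eval_nat_numeral)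
  have eqs_iff: "(\<forall>a\<in>words 1 1. \<forall>b\<in>words 1 1.
      (\<Sum>c\<in>words 1 1. \<Sum>d\<in>words 1 1. lform a c * H c d * lform d b) = lform a b) \<longleftrightarrow>
     (H [1,2] [1,2] = 1 - p ^ 2 \<and> H [2,1] [2,1] = 1 - p ^ 2 \<and>
      H [1,2] [2,1] = - p * (1 - p ^ 2) \<and> H [2,1] [1,2] = - p * (1 - p ^ 2))" (is "?L \<longleftrightarrow> ?R") for H
  proof -
    show ?thesis
      unfolding gram_inverse_2[OF r(2), symmetric]
      by (simp add: words_1_1 form del: lform.simps One_nat_def)
  qed
  have "\<exists>H. \<forall>a\<in>words 1 1. \<forall>b\<in>words 1 1.
      (\<Sum>c\<in>words 1 1. \<Sum>d\<in>words 1 1. lform a c * H c d * lform d b) = lform a b"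
    unfolding eqs_iff
    by (rule exI[of _ "\<lambda>a b. if a = b then 1 - p ^ 2 else - p * (1 - p ^ 2)"]) simp
  from someI_ex[OF this, unfolded eqs_iff]
  have "gram_ginv 1 1 [1,2] [1,2] = 1 - p ^ 2 \<and> gram_ginv 1 1 [2,1] [2,1] = 1 - p ^ 2 \<and>
      gram_ginv 1 1 [1,2] [2,1] = - p * (1 - p ^ 2) \<and> gram_ginv 1 1 [2,1] [1,2] = - p * (1 - p ^ 2)"
    unfolding gram_ginv_def eqs_iff .
  then show "thetabar_coef 1 1 [1, 2] [1, 2] = inverse (qh ^ 2) - 1"
  "thetabar_coef 1 1 [2, 1] [2, 1] = inverse (qh ^ 2) - 1"
  "thetabar_coef 1 1 [1, 2] [2, 1] = theta_a"
  "thetabar_coef 1 1 [2, 1] [1, 2] = theta_a"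
    unfolding thetabar_coef_def theta_a_def p_def
    by (simp_all add: barK_simps del: One_nat_def) (simp_all add: field_simps power2_eq_square)
qed

lemmas words_small = words_0_0 words_2_0 words_0_2
  words_1_0[unfolded One_nat_def] words_0_1[unfolded One_nat_def] words_1_1[unfolded One_nat_def]

lemmas thetabar_coefs = thetabar_coef_0_0 thetabar_coef_1_1[unfolded One_nat_def]
  thetabar_coef_single[OF words_1_0, unfolded One_nat_def]
  thetabar_coef_single[OF words_0_1, unfolded One_nat_def]

lemma gen_act_F_single:
  "gen_act [s] (Fgen i) f J = (if valid [s] J
     then \<Sum>j'\<in>{-1, 0, 1}. if tgt s (Fgen i) j' = Some (hd J) then f [j'] else 0 else 0)"
  by (cases J) (auto simp: gen_act_def kfac_def cong: if_cong)

text \<open>One factor on the left leaves total degree at most 2. The weights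
  \<open>2\<alpha>_i\<close> drop out since \<open>F_i^2 = 0\<close> there; in weight
  \<open>\<alpha>_1 + \<alpha>_2\<close> only \<open>F_lo F_hi\<close>, taking \<open>e_1\<close> to
  \<open>e_{-1}\<close>, is nonzero, and it is paired with both \<open>E\<close>-words.\<close>

lemma thetabar_tri:
  assumes supp: "supp S x" "supp S y" "supp S z"
  shows "thetabar [s] S (tri x y z) = tri x (vadd y (vscale theta_a (Ehi s S x)))
    (vadd z (vadd (vscale theta_a (Elo s S y)) (vadd (vscale theta_a (Ehi s S (Elo s S x)))
      (vscale (inverse (qh ^ 2) - 1) (Elo s S (Ehi s S x))))))" (is "_ = tri x ?y ?z")
proof
  fix J
  have weights: "{(n1, n2). n1 + n2 \<le> (2::nat)} = {(0, 0), (1, 0), (0, 1), (2, 0), (0, 2), (1, 1)}"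
    by auto
  show "thetabar [s] S (tri x y z) J = tri x ?y ?z J"
  proof (cases J)
    case Nil
    then show ?thesis by (simp add: thetabar_def op_left_def)
  next
    case (Cons j J')
    show ?thesis
    proof (cases "j = 1 \<or> j = 0 \<or> j = -1")
      case True
      then show ?thesis
        by (cases s; elim disjE)
          (simp_all add: Cons thetabar_def weights words_small thetabar_coefs op_left_def op_right_def
            word_act_def gen_act_F_single tri_Cons vec_defs)
    next
      case False
      then show ?thesis
        by (simp add: Cons thetabar_def weights words_small op_left_def op_right_def
            word_act_def gen_act_F_single tri_Cons)
    qed
  qed
qed

text \<open>The separate clause of \<open>phi\<close> for one factor agrees with the general
  recursion because \<open>gen_act\<close> vanishes on the empty product. Supports are proved
  simultaneously, as \<open>thetabar_tri\<close> needs them on the tail.\<close>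

lemma phi_Cons: "phi (s # S) x = thetabar [s] S
    (tri (phi S (\<lambda>J. x (1 # J))) (phi S (\<lambda>J. x (0 # J))) (phi S (\<lambda>J. x (-1 # J))))"
  and supp_phi: "supp S (phi S x)"
proof (induction S arbitrary: s x)
  case Nil
  have supp: "supp [] (phi [] x)" for x by (simp add: supp_def)
  { case 1
    show ?case
      unfolding thetabar_tri[OF supp supp supp]
    proof
      fix J :: "int list"
      show "phi [s] x J = tri (phi [] (\<lambda>J. x (1 # J)))
         (vadd (phi [] (\<lambda>J. x (0 # J))) (vscale theta_a (Ehi s [] (phi [] (\<lambda>J. x (1 # J))))))
         (vadd (phi [] (\<lambda>J. x (-1 # J)))
         (vadd (vscale theta_a (Elo s [] (phi [] (\<lambda>J. x (0 # J)))))
         (vadd (vscale theta_a (Ehi s [] (Elo s [] (phi [] (\<lambda>J. x (1 # J))))))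
         (vscale (inverse (qh ^ 2) - 1) (Elo s [] (Ehi s [] (phi [] (\<lambda>J. x (1 # J))))))))) J"
        by (cases J) (auto simp: tri_Cons vec_defs)
    qed
  next
    case 2
    show ?case by (rule supp)
  }
next
  case (Cons s' S)
  { case 1
    show ?case
      by (auto simp: tri_def intro!: arg_cong[of _ _ "thetabar [s] (s' # S)"] split: list.split)
  next
    case 2
    show ?case
      unfolding Cons.IH(1) using Cons.IH(2) by (simp add: thetabar_tri)
  }
qed

lemma phi_tri: "phi (s # S) (tri x y z) = tri (phi S x) (vadd (phi S y) (vscale theta_a (Ehi s S (phi S x))))
    (vadd (phi S z) (vadd (vscale theta_a (Elo s S (phi S y))) (vadd (vscale theta_a (Ehi s S (Elo s S (phi S x))))
      (vscale (inverse (qh ^ 2) - 1) (Elo s S (Ehi s S (phi S x)))))))"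
  by (simp add: phi_Cons thetabar_tri supp_phi)

lemma phi_vadd [simp]: "phi S (vadd x y) = vadd (phi S x) (phi S y)"
proof (induction S arbitrary: x y)
  case Nil
  show ?case by (auto simp: vadd_def barK_add)
next
  case (Cons s S)
  have "(\<lambda>J. vadd x y (j # J)) = vadd (\<lambda>J. x (j # J)) (\<lambda>J. y (j # J))" for j
    by (simp add: vadd_def)
  then show ?case
    by (simp add: phi_Cons thetabar_tri supp_phi Cons.IH)
      (simp add: vec_defs fun_eq_iff algebra_simps)
qed

lemma phi_vscale [simp]: "phi S (vscale c x) = vscale (barK c) (phi S x)"
proof (induction S arbitrary: x)
  case Nil
  show ?case by (auto simp: vscale_def barK_mult)
next
  case (Cons s S)
  have "(\<lambda>J. vscale c x (j # J)) = vscale c (\<lambda>J. x (j # J))" for j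
    by (simp add: vscale_def)
  then show ?case
    by (simp add: phi_Cons thetabar_tri supp_phi Cons.IH)
      (simp add: vec_defs fun_eq_iff algebra_simps)
qed

lemma phi_vzero [simp]: "phi S vzero = vzero"
  using phi_vscale[of S 0 vzero] by (simp add: vscale_def vzero_def)

text \<open>Uniqueness: the coefficient of \<open>e\<^sub>1\<close> in the first factor is itself \<open>\<Phi>\<close>-fixed, and once it vanishes,
  so are the coefficients of \<open>e\<^sub>0\<close> and then of \<open>e\<^sub>-\<^sub>1\<close>.\<close>
lemma phi_fixed_in_vinv_lattice_eq_0:
  assumes "supp S x" "phi S x = x" "\<And>J. x J \<in> vinv_lattice"
  shows "x = vzero"
  using assms
proof (induction S arbitrary: x)
  case Nil
  have "barK (x []) = x []" using fun_cong[OF Nil.prems(2), of "[]"] by simp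
  then have "x [] = 0" using Nil.prems(3) by (rule vinv_lattice_bar_fixed[rotated])
  then have "x J = 0" for J
    using Nil.prems(1) by (cases "J = []") (auto simp: supp_def)
  then show ?case by (simp add: vzero_def fun_eq_iff)
next
  case (Cons s S)
  obtain x1 x0 xm where x: "x = tri x1 x0 xm" and supp: "supp S x1" "supp S x0" "supp S xm"
    using Cons.prems(1) by (rule supp_ConsE)
  have lat: "x1 J \<in> vinv_lattice" "x0 J \<in> vinv_lattice" "xm J \<in> vinv_lattice" for J
    using Cons.prems(3)[of "1 # J"] Cons.prems(3)[of "0 # J"] Cons.prems(3)[of "-1 # J"]
    by (simp_all add: x tri_Cons)
  note fixed = Cons.prems(2)[unfolded x phi_tri tri_eq_iff]
  have [simp]: "vadd y vzero = y" "vscale c vzero = vzero" for y c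
    by (simp_all add: vec_defs)
  have x1: "x1 = vzero"
    using fixed supp lat by (intro Cons.IH) auto
  have x0: "x0 = vzero"
    using fixed supp lat by (intro Cons.IH) (auto simp: x1)
  have "xm = vzero"
    using fixed supp lat by (intro Cons.IH) (auto simp: x1 x0)
  then show ?case by (simp add: x x1 x0)
qed

text \<open>Two vectors meeting the defining conditions differ by a \<Phi>-fixed vector with all
  coefficients in the lattice, which is zero.\<close>

lemma dual_can_elt_eqI:
  assumes supp: "supp S y" and fixed: "phi S y = y"
    and lead: "\<And>J'. y J' - basis_vec J J' \<in> vinv_lattice"
  shows "dual_can_elt S J = y"
  unfolding dual_can_elt_def
proof (rule the_equality)
  show "(\<forall>J'. \<not> valid S J' \<longrightarrow> y J' = 0) \<and> phi S y = y \<and> (\<forall>J'. y J' - basis_vec J J' \<in> vinv_lattice)"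
    using assms by (simp add: supp_def)
next
  fix z
  assume z: "(\<forall>J'. \<not> valid S J' \<longrightarrow> z J' = 0) \<and> phi S z = z \<and> (\<forall>J'. z J' - basis_vec J J' \<in> vinv_lattice)"
  define x where "x = vadd z (vscale (- 1) y)"
  have "x = vzero"
  proof (rule phi_fixed_in_vinv_lattice_eq_0)
    show "supp S x" using supp z by (simp add: x_def supp_def vec_defs)
    show "phi S x = x" using fixed z by (simp add: x_def barK_uminus)
    fix J'
    show "x J' \<in> vinv_lattice"
      using vinv_lattice_diff[OF z[THEN conjunct2, THEN conjunct2, rule_format, of J'] lead[of J']]
      by (simp add: x_def vec_defs)
  qed
  then show "z = y" by (simp add: x_def vec_defs fun_eq_iff)
qed

section \<open>Equivariance of the elementary web pieces\<close>

lemma Serre_relation: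
  assumes "supp S x" "i \<in> {1, 2}" "j \<in> {1, 2}" "i \<noteq> j"
  shows "vadd (gen_act S (Egen i) (gen_act S (Egen i) (gen_act S (Egen j) x)))
      (gen_act S (Egen j) (gen_act S (Egen i) (gen_act S (Egen i) x))) =
    vscale (qh + inverse qh) (gen_act S (Egen i) (gen_act S (Egen j) (gen_act S (Egen i) x)))"
  using assms
proof (induction S arbitrary: x)
  case Nil
  then show ?case by (simp add: vec_defs)
next
  case (Cons s S)
  obtain x1 x0 xm where x: "x = tri x1 x0 xm" and supp: "supp S x1" "supp S x0" "supp S xm"
    using Cons.prems(1) by (rule supp_ConsE)
  \<comment> \<open>Oriented so as to eliminate \<open>E_j E_i E_i\<close>, which lets
    simplification compare the words in the \<open>E\<close>'s on the tail.\<close>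
  have IH: "gen_act S (Egen j) (gen_act S (Egen i) (gen_act S (Egen i) y)) J =
      (qh + inverse qh) * gen_act S (Egen i) (gen_act S (Egen j) (gen_act S (Egen i) y)) J
      - gen_act S (Egen i) (gen_act S (Egen i) (gen_act S (Egen j) y)) J"
    if "supp S y" for y J
    using fun_cong[OF Cons.IH[OF that Cons.prems(2-4)], of J] by (simp add: vec_defs algebra_simps)
  consider "i = hi s" "j = lo s" | "i = lo s" "j = hi s"
    using Cons.prems by (cases s) auto
  then show ?case
  proof cases
    case 1
    then show ?thesis
      using supp
      by (simp add: x Ehi_tri Elo_tri)
        (simp add: vec_defs fun_eq_iff IH[unfolded 1] field_simps)
  next
    case 2
    then show ?thesis
      using supp
      by (simp add: x Ehi_tri Elo_tri)
        (simp add: vec_defs fun_eq_iff IH[unfolded 2] field_simps)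
  qed
qed

text \<open>Compatibility with the \<open>E_i\<close> is carried along with that for \<Phi>, because
  the recursion for \<Phi> applies the \<open>E_i\<close> to the tail.\<close>

definition equivariant :: "sgn list \<Rightarrow> sgn list \<Rightarrow> (vec \<Rightarrow> vec) \<Rightarrow> bool" where
  "equivariant A B f \<longleftrightarrow>
     (\<forall>x y. f (vadd x y) = vadd (f x) (f y)) \<and> (\<forall>c x. f (vscale c x) = vscale c (f x)) \<and>
     (\<forall>x. supp A x \<longrightarrow> supp B (f x) \<and> phi B (f x) = f (phi A x) \<and>
        (\<forall>i\<in>{1, 2}. gen_act B (Egen i) (f x) = f (gen_act A (Egen i) x)))"

lemma hi_lo_cases: "(\<forall>i\<in>{1, 2}. P i) \<longleftrightarrow> P (hi s) \<and> P (lo s)"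
  by (cases s) auto

lemma equivariant_comp:
  "equivariant A B f \<Longrightarrow> equivariant B C g \<Longrightarrow> equivariant A C (\<lambda>x. g (f x))"
  by (simp add: equivariant_def)

definition on_tail :: "(vec \<Rightarrow> vec) \<Rightarrow> vec \<Rightarrow> vec" where
  "on_tail f x = (\<lambda>J. case J of [] \<Rightarrow> 0 | j # J' \<Rightarrow> f (\<lambda>J. x (j # J)) J')"

lemma on_tail_tri:
  assumes "f vzero = vzero"
  shows "on_tail f (tri x y z) = tri (f x) (f y) (f z)"
proof
  fix J
  \<comment> \<open>\<open>on_tail\<close> also applies \<open>f\<close> to slices at indices
    outside \<open>{1, 0, -1}\<close>; this is where \<open>f vzero = vzero\<close> enters.\<close>
  have "(\<lambda>J. tri x y z (j # J)) = vzero" if "j \<notin> {1, 0, -1}" for j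
    using that by (simp add: tri_Cons vzero_def)
  then show "on_tail f (tri x y z) J = tri (f x) (f y) (f z) J"
    using fun_cong[OF assms] by (cases J) (auto simp: on_tail_def tri_Cons vzero_def)
qed

text \<open>On a vector \<open>tri\<close>, \<Phi> and the \<open>E_i\<close> are linear
  combinations of \<Phi> and \<open>E\<close>-words applied to the three tail components, and
  \<open>f\<close> commutes with all of these.\<close>

lemma equivariant_on_tail:
  assumes "equivariant A B f"
  shows "equivariant (s # A) (s # B) (on_tail f)"
proof -
  have add: "f (vadd x y) = vadd (f x) (f y)" and scale: "f (vscale c x) = vscale c (f x)" for x y c
    using assms by (simp_all add: equivariant_def)
  have zero: "f vzero = vzero"
    using scale[of 0 vzero] by (simp add: vec_defs)
  have f: "supp B (f x)" "phi B (f x) = f (phi A x)" "Ehi s' B (f x) = f (Ehi s' A x)"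
    "Elo s' B (f x) = f (Elo s' A x)" if "supp A x" for x s'
    using assms that by (cases s'; simp add: equivariant_def)+
  have "on_tail f (vadd x y) = vadd (on_tail f x) (on_tail f y)" for x y
    using add by (simp add: on_tail_def vadd_def fun_eq_iff split: list.split)
  moreover have "on_tail f (vscale c x) = vscale c (on_tail f x)" for x c
    using scale by (simp add: on_tail_def vscale_def fun_eq_iff split: list.split)
  moreover have "supp (s # B) (on_tail f x) \<and> phi (s # B) (on_tail f x) = on_tail f (phi (s # A) x) \<and>
        (\<forall>i\<in>{1, 2}. gen_act (s # B) (Egen i) (on_tail f x) = on_tail f (gen_act (s # A) (Egen i) x))"
    if "supp (s # A) x" for x
    using that unfolding hi_lo_cases[of _ s]
  proof (rule supp_ConsE, goal_cases)
    case (1 x1 x0 xm)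
    then show ?case
      by (simp add: on_tail_tri[where f = f, OF zero] f supp_phi phi_tri Ehi_tri Elo_tri add scale)
  qed
  ultimately show ?thesis by (simp add: equivariant_def)
qed

fun opp :: "sgn \<Rightarrow> sgn" where "opp Pl = Mi" | "opp Mi = Pl"

lemma hi_opp [simp]: "hi (opp s) = lo s" and lo_opp [simp]: "lo (opp s) = hi s"
  by (cases s; simp)+

text \<open>Passing to the dual factor exchanges \<open>hi\<close> and \<open>lo\<close>, so the
  checks below can be written in \<open>Ehi s\<close> and \<open>Elo s\<close> alone, uniformly in
  \<open>s\<close>.\<close>

lemmas opp_tri = Ehi_tri[where s = "opp s" for s, unfolded hi_opp] Elo_tri[where s = "opp s" for s, unfolded lo_opp]
  phi_tri[where s = "opp s" for s, unfolded hi_opp lo_opp]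

lemma vv_cancel: "vv * inverse vv = 1" "inverse vv * vv = 1" "vv * (inverse vv * x) = x" "inverse vv * (vv * x) = x"
  by (simp_all flip: mult.assoc)

lemma apply_op_vadd: "apply_op u (vadd x y) = vadd (apply_op u x) (apply_op u y)"
  by (cases u) (auto simp: fun_eq_iff vec_defs algebra_simps)

lemma apply_op_vscale: "apply_op u (vscale c x) = vscale c (apply_op u x)"
  by (cases u) (auto simp: fun_eq_iff vec_defs algebra_simps)

lemma Cup_0: "apply_op (Cup 0 a b) x =
    tri (tri vzero vzero x) (tri vzero (vscale (inverse vv) x) vzero) (tri (vscale (inverse vv ^ 2) x) vzero vzero)"
    (is "_ = ?r")
proof
  fix J :: "int list"
  consider "J = []" | j where "J = [j]" | j k J' where "J = j # k # J'"
    by (metis list.exhaust)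
  then show "apply_op (Cup 0 a b) x J = ?r J"
    by cases (auto simp: tri_Cons cup_coef_def vec_defs)
qed

text \<open>Expanding both new factors leaves identities between \<open>E\<close>-words applied to
  \<open>x\<close>; with \<open>qh = - vv\<close> the extra terms cancel.\<close>

lemma equivariant_Cup_0: "equivariant S (s # opp s # S) (apply_op (Cup 0 s (opp s)))"
  unfolding equivariant_def hi_lo_cases[of _ s]
proof (intro conjI allI impI)
  fix x assume "supp S x"
  then show "supp (s # opp s # S) (apply_op (Cup 0 s (opp s)) x)"
    "Ehi s (s # opp s # S) (apply_op (Cup 0 s (opp s)) x) = apply_op (Cup 0 s (opp s)) (Ehi s S x)"
    "Elo s (s # opp s # S) (apply_op (Cup 0 s (opp s)) x) = apply_op (Cup 0 s (opp s)) (Elo s S x)"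
    "phi (s # opp s # S) (apply_op (Cup 0 s (opp s)) x) = apply_op (Cup 0 s (opp s)) (phi S x)"
    unfolding Cup_0
    by (simp_all add: Ehi_tri Elo_tri phi_tri opp_tri supp_phi barK_simps)
      (simp_all add: vec_defs fun_eq_iff qh_def theta_a_def algebra_simps power2_eq_square vv_cancel)
qed (simp_all add: apply_op_vadd apply_op_vscale del: apply_op.simps)

lemma Cap_0: "apply_op (Cap 0 a b) (tri (tri x11 x10 x1m) (tri x01 x00 x0m) (tri xm1 xm0 xmm)) =
    vadd (vscale (vv ^ 2) x1m) (vadd (vscale vv x00) xm1)"
  by (auto simp: fun_eq_iff tri_Cons cap_coef_def vec_defs)

lemma equivariant_Cap_0: "equivariant (s # opp s # S) S (apply_op (Cap 0 s (opp s)))"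
  unfolding equivariant_def hi_lo_cases[of _ s]
proof (intro conjI allI impI)
  fix x assume "supp (s # opp s # S) x"
  then obtain x1 x0 xm where x: "x = tri x1 x0 xm"
    and supp1: "supp (opp s # S) x1" "supp (opp s # S) x0" "supp (opp s # S) xm"
    by (rule supp_ConsE)
  obtain x11 x10 x1m where x1: "x1 = tri x11 x10 x1m" and s1: "supp S x11" "supp S x10" "supp S x1m"
    using supp1(1) by (rule supp_ConsE)
  obtain x01 x00 x0m where x0: "x0 = tri x01 x00 x0m" and s0: "supp S x01" "supp S x00" "supp S x0m"
    using supp1(2) by (rule supp_ConsE)
  obtain xm1 xm0 xmm where xm: "xm = tri xm1 xm0 xmm" and sm: "supp S xm1" "supp S xm0" "supp S xmm"
    using supp1(3) by (rule supp_ConsE)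
  show "supp S (apply_op (Cap 0 s (opp s)) x)"
    "Ehi s S (apply_op (Cap 0 s (opp s)) x) = apply_op (Cap 0 s (opp s)) (Ehi s (s # opp s # S) x)"
    "Elo s S (apply_op (Cap 0 s (opp s)) x) = apply_op (Cap 0 s (opp s)) (Elo s (s # opp s # S) x)"
    "phi S (apply_op (Cap 0 s (opp s)) x) = apply_op (Cap 0 s (opp s)) (phi (s # opp s # S) x)"
    using s1 s0 sm unfolding x x1 x0 xm Cap_0
    by (simp_all add: Ehi_tri Elo_tri phi_tri opp_tri supp_phi barK_simps Cap_0 del: apply_op.simps)
      (simp_all add: vec_defs fun_eq_iff qh_def theta_a_def algebra_simps power2_eq_square vv_cancel)
qed (simp_all add: apply_op_vadd apply_op_vscale del: apply_op.simps)

text \<open>The embedding of \<open>V\<^bsup>-s\<^esup>\<close> into \<open>V\<^sup>s \<otimes> V\<^sup>s\<close>, a trivalent vertex with one edge pointing down.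
  It allows equivariance of the upward vertex to be checked on two tensor factors instead of three.\<close>
definition split_op :: "vec \<Rightarrow> vec" where
  "split_op x = (let x1 = (\<lambda>J. x (1 # J)); x0 = (\<lambda>J. x (0 # J)); xm = (\<lambda>J. x (-1 # J)) in
     tri (tri vzero x1 x0) (tri (vscale (inverse vv) x1) vzero xm)
       (tri (vscale (inverse vv) x0) (vscale (inverse vv) xm) vzero))"

lemma split_op_tri: "split_op (tri x1 x0 xm) = tri (tri vzero x1 x0) (tri (vscale (inverse vv) x1) vzero xm)
       (tri (vscale (inverse vv) x0) (vscale (inverse vv) xm) vzero)"
  by (simp add: split_op_def)

lemma equivariant_split_op: "equivariant (opp s # S) (s # s # S) split_op"
  unfolding equivariant_def hi_lo_cases[of _ s]
proof (intro conjI allI impI)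
  fix x assume "supp (opp s # S) x"
  then obtain x1 x0 xm where x: "x = tri x1 x0 xm" and supp: "supp S x1" "supp S x0" "supp S xm"
    by (rule supp_ConsE)
  have "hi s \<in> {1, 2}" "lo s \<in> {1, 2}" "hi s \<noteq> lo s" by (cases s; simp)+
  \<comment> \<open>Both Serre relations as rewrite rules, eliminating \<open>Elo Ehi Ehi\<close>
    and \<open>Ehi Elo Elo\<close>.\<close>
  then have Serre: "Elo s S (Ehi s S (Ehi s S y)) J =
      (qh + inverse qh) * Ehi s S (Elo s S (Ehi s S y)) J - Ehi s S (Ehi s S (Elo s S y)) J"
     "Ehi s S (Elo s S (Elo s S y)) J =
      (qh + inverse qh) * Elo s S (Ehi s S (Elo s S y)) J - Elo s S (Elo s S (Ehi s S y)) J"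
    if "supp S y" for y J
    using fun_cong[OF Serre_relation[OF that, of "hi s" "lo s"], of J]
      fun_cong[OF Serre_relation[OF that, of "lo s" "hi s"], of J]
    by (simp_all add: vec_defs algebra_simps)
  show "supp (s # s # S) (split_op x)"
    "Ehi s (s # s # S) (split_op x) = split_op (Ehi s (opp s # S) x)"
    "Elo s (s # s # S) (split_op x) = split_op (Elo s (opp s # S) x)"
    "phi (s # s # S) (split_op x) = split_op (phi (opp s # S) x)"
    using supp unfolding x split_op_tri
    by (simp_all add: Ehi_tri Elo_tri phi_tri opp_tri supp_phi barK_simps split_op_tri)
      (simp_all add: vec_defs fun_eq_iff Serre supp_phi qh_def theta_a_def algebra_simps power2_eq_square vv_cancel)
qed (simp_all add: split_op_def Let_def, simp_all add: vec_defs algebra_simps)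

lemma split_op_tri_coef: "tri (split_op (tri vzero vzero x)) (split_op (tri vzero (vscale (inverse vv) x) vzero))
     (split_op (tri (vscale (inverse vv ^ 2) x) vzero vzero)) (j # k # l # J) = tri_coef j k l * x J" (is "?L = _")
proof -
  have "?L =
     (if j = 1 then
        if k = 0 then if l = -1 then x J else 0
        else if k = -1 then if l = 0 then inverse vv * x J else 0 else 0
      else if j = 0 then
        if k = 1 then if l = -1 then inverse vv * x J else 0
        else if k = -1 then if l = 1 then inverse vv * (inverse vv * x J) else 0 else 0
      else if j = -1 then
        if k = 1 then if l = 0 then inverse vv ^ 2 * x J else 0
        else if k = 0 then if l = 1 then inverse vv * (inverse vv ^ 2 * x J) else 0 else 0
      else 0)"
    unfolding split_op_tri tri_Cons by (simp add: vscale_def vzero_def)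
  also have "\<dots> = tri_coef j k l * x J"
    by (simp add: tri_coef_def power2_eq_square power3_eq_cube)
  finally show ?thesis .
qed

text \<open>Diagrammatically, a tripod is a cup whose right leg branches.\<close>

lemma Vtx_0: "apply_op (Vtx 0 s) x = on_tail split_op (apply_op (Cup 0 s (opp s)) x)"
proof
  fix J :: "int list"
  have "vscale c vzero = vzero" for c by (simp add: vec_defs)
  then have zero: "split_op vzero = vzero"
    using split_op_tri[of vzero vzero vzero] by simp
  have rhs: "on_tail split_op (apply_op (Cup 0 s (opp s)) x) =
     tri (split_op (tri vzero vzero x)) (split_op (tri vzero (vscale (inverse vv) x) vzero))
       (split_op (tri (vscale (inverse vv ^ 2) x) vzero vzero))"
    unfolding Cup_0 by (rule on_tail_tri[where f = split_op, OF zero])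
  consider "J = []" | j where "J = [j]" | j k where "J = [j, k]" | j k l J' where "J = j # k # l # J'"
    by (metis list.exhaust)
  then show "apply_op (Vtx 0 s) x J = on_tail split_op (apply_op (Cup 0 s (opp s)) x) J"
  proof cases
    case 4
    then show ?thesis by (simp only: rhs split_op_tri_coef) simp
  qed (simp_all only: rhs, simp_all add: split_op_tri tri_Cons vzero_def)
qed

lemma equivariant_Vtx_0: "equivariant S (s # s # s # S) (apply_op (Vtx 0 s))"
  unfolding Vtx_0
  by (rule equivariant_comp[OF equivariant_Cup_0 equivariant_on_tail[OF equivariant_split_op]])

section \<open>Slices at arbitrary positions and whole webs\<close>

fun fits :: "slice_op \<Rightarrow> sgn list \<Rightarrow> bool" where
  "fits (Cup k a b) L \<longleftrightarrow> k \<le> length L \<and> b = opp a"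
| "fits (Vtx k s) L \<longleftrightarrow> k \<le> length L"
| "fits (Cap k a b) L \<longleftrightarrow> k + 2 \<le> length L \<and> L ! k = a \<and> L ! (k + 1) = b \<and> b = opp a"

lemma apply_op_Suc:
  "apply_op (Cup (Suc k) a b) = on_tail (apply_op (Cup k a b))"
  "apply_op (Vtx (Suc k) s) = on_tail (apply_op (Vtx k s))"
  "apply_op (Cap (Suc k) a b) = on_tail (apply_op (Cap k a b))"
  by (auto simp: fun_eq_iff on_tail_def eval_nat_numeral split: list.split)

text \<open>By \<open>apply_op_Suc\<close>, a slice one position further right acts on the tail
  only; induction on the position reduces to the pieces at position 0.\<close>

lemma equivariant_apply_op:
  "fits u L \<Longrightarrow> equivariant L (op_labels u L) (apply_op u)"
proof (cases u)
  case (Cup k a b)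
  moreover have "k \<le> length L \<Longrightarrow> equivariant L (op_labels (Cup k a (opp a)) L) (apply_op (Cup k a (opp a)))"
  proof (induction k arbitrary: L)
    case 0
    then show ?case using equivariant_Cup_0[of L a] by (simp del: apply_op.simps)
  next
    case (Suc k)
    then obtain s L' where "L = s # L'" by (cases L) auto
    then show ?case
      using Suc equivariant_on_tail[OF Suc.IH[of L'], of s] by (simp add: apply_op_Suc del: apply_op.simps)
  qed
  ultimately show "fits u L \<Longrightarrow> ?thesis" by (simp del: apply_op.simps)
next
  case (Vtx k s)
  moreover have "k \<le> length L \<Longrightarrow> equivariant L (op_labels (Vtx k s) L) (apply_op (Vtx k s))"
  proof (induction k arbitrary: L)
    case 0
    then show ?case using equivariant_Vtx_0[of L s] by (simp del: apply_op.simps)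
  next
    case (Suc k)
    then obtain s' L' where "L = s' # L'" by (cases L) auto
    then show ?case
      using Suc equivariant_on_tail[OF Suc.IH[of L'], of s'] by (simp add: apply_op_Suc del: apply_op.simps)
  qed
  ultimately show "fits u L \<Longrightarrow> ?thesis" by (simp del: apply_op.simps)
next
  case (Cap k a b)
  moreover have "fits (Cap k a (opp a)) L \<Longrightarrow> equivariant L (op_labels (Cap k a (opp a)) L) (apply_op (Cap k a (opp a)))"
  proof (induction k arbitrary: L)
    case 0
    then obtain L' where "L = a # opp a # L'"
      by (cases L; cases "tl L") auto
    then show ?case using equivariant_Cap_0[of a L'] by (simp del: apply_op.simps)
  next
    case (Suc k)
    then obtain s' L' where "L = s' # L'" by (cases L) auto
    then show ?case
      using Suc equivariant_on_tail[OF Suc.IH[of L'], of s'] by (simp add: apply_op_Suc del: apply_op.simps)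
  qed
  ultimately show "fits u L \<Longrightarrow> ?thesis" by (auto simp del: apply_op.simps)
qed

fun fits_all :: "slice_op list \<Rightarrow> sgn list \<Rightarrow> bool" where
  "fits_all [] L \<longleftrightarrow> True"
| "fits_all (u # us) L \<longleftrightarrow> fits u L \<and> fits_all us (op_labels u L)"

lemma equivariant_slices:
  "fits_all us L \<Longrightarrow> equivariant L (fold op_labels us L) (fold apply_op us)"
proof (induction us arbitrary: L)
  case Nil
  then show ?case by (simp add: equivariant_def)
next
  case (Cons u us)
  then show ?case
    using equivariant_comp[OF equivariant_apply_op[of u L] Cons.IH[of "op_labels u L"]]
    by (simp add: comp_def del: apply_op.simps)
qed

text \<open>The value of a web is the image of the \<open>\<Phi>\<close>-fixed vector 1 of the trivial representation.\<close>
lemma eval_slices_phi_fixed: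
  assumes "fits_all us []"
  defines "S \<equiv> fold op_labels us []"
  shows "phi S (eval_slices us) = eval_slices us" and "supp S (eval_slices us)"
proof -
  define e :: vec where "e = (\<lambda>J. if J = [] then 1 else 0)"
  have e: "supp [] e" "phi [] e = e"
    by (auto simp: e_def supp_def)
  have eval: "eval_slices us = fold apply_op us e"
    by (simp add: eval_slices_def e_def)
  show "phi S (eval_slices us) = eval_slices us" "supp S (eval_slices us)"
    using equivariant_slices[OF assms(1)] e unfolding eval S_def by (simp_all add: equivariant_def)
qed

lemma fits_all_w1: "fits_all w1_slices []"
  by (simp add: w1_slices_def)

lemma fits_all_w2: "fits_all w2_slices []"
  by (simp add: w2_slices_def)

lemmas web_w1_phi_fixed = eval_slices_phi_fixed[OF fits_all_w1, folded web_w1_def, unfolded w1_boundary]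
lemmas web_w2_phi_fixed = eval_slices_phi_fixed[OF fits_all_w2, folded web_w2_def, unfolded w2_boundary]

section \<open>Sweeping over the coronene web\<close>

lemma on_tail_comp: "on_tail f (on_tail g x) = on_tail (\<lambda>y. f (g y)) x"
  by (auto simp: on_tail_def fun_eq_iff split: list.split)

text \<open>Slices touching disjoint strands commute up to renumbering. This rule and the three that
  follow all execute the operation further left first, so rewriting with them orders a slice word
  from left to right.\<close>

lemma Cap_Vtx_swap:
  "j + 2 \<le> k \<Longrightarrow> apply_op (Cap j a b) (apply_op (Vtx k s) x) = apply_op (Vtx (k - 2) s) (apply_op (Cap j a b) x)"
proof (induction j arbitrary: k x)
  case 0
  then obtain k' where "k = Suc (Suc k')" by (metis add_2_eq_Suc' le_iff_add add.commute add_0)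
  then show ?case
    by (auto simp: apply_op_Suc on_tail_def fun_eq_iff algebra_simps)
next
  case (Suc j)
  then obtain m where k: "k = Suc m" "j + 2 \<le> m" "Suc m - 2 = Suc (m - 2)" by (cases k) auto
  show ?case
    unfolding k(1) k(3) apply_op_Suc on_tail_comp Suc.IH[OF k(2)] ..
qed

lemma Cap_Cap_swap:
  "j + 2 \<le> k \<Longrightarrow> apply_op (Cap j a b) (apply_op (Cap k c d) x) = apply_op (Cap (k - 2) c d) (apply_op (Cap j a b) x)"
proof (induction j arbitrary: k x)
  case 0
  then obtain k' where "k = Suc (Suc k')" by (metis add_2_eq_Suc' le_iff_add add.commute add_0)
  then show ?case
    by (auto simp: apply_op_Suc on_tail_def fun_eq_iff algebra_simps)
next
  case (Suc j)
  then obtain m where k: "k = Suc m" "j + 2 \<le> m" "Suc m - 2 = Suc (m - 2)" by (cases k) auto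
  show ?case
    unfolding k(1) k(3) apply_op_Suc on_tail_comp Suc.IH[OF k(2)] ..
qed

lemma Vtx_Vtx_swap:
  "j \<le> k \<Longrightarrow> apply_op (Vtx j s) (apply_op (Vtx k t) x) = apply_op (Vtx (k + 3) t) (apply_op (Vtx j s) x)"
proof (induction j arbitrary: k x)
  case 0
  show ?case
    by (simp add: numeral_3_eq_3 apply_op_Suc del: apply_op.simps)
      (auto simp: on_tail_def fun_eq_iff algebra_simps eval_nat_numeral split: list.split)
next
  case (Suc j)
  then obtain m where k: "k = Suc m" "j \<le> m" by (cases k) auto
  show ?case
    unfolding k(1) add_Suc apply_op_Suc on_tail_comp Suc.IH[OF k(2)] ..
qed

lemma Vtx_Cap_swap:
  "j \<le> k \<Longrightarrow> apply_op (Vtx j s) (apply_op (Cap k a b) x) = apply_op (Cap (k + 3) a b) (apply_op (Vtx j s) x)"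
proof (induction j arbitrary: k x)
  case 0
  show ?case
    by (simp add: numeral_3_eq_3 apply_op_Suc del: apply_op.simps)
      (auto simp: on_tail_def fun_eq_iff algebra_simps eval_nat_numeral split: list.split)
next
  case (Suc j)
  then obtain m where k: "k = Suc m" "j \<le> m" by (cases k) auto
  show ?case
    unfolding k(1) add_Suc apply_op_Suc on_tail_comp Suc.IH[OF k(2)] ..
qed

text \<open>One sixth of the web, read off in angular order: it turns the running pair of the outer and the inner
  cycle at positions 0 and 1 into two boundary edges and the next running pair. Signs are
  irrelevant for the evaluation and are filled in arbitrarily.\<close>
definition sector :: "slice_op list" where
  "sector = [Vtx 1 Pl, Cap 0 Pl Mi, Vtx 3 Pl, Cap 2 Pl Mi, Vtx 3 Pl, Cap 2 Pl Mi, Cap 1 Pl Mi,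
     Vtx 2 Pl, Cap 1 Pl Mi]"

fun shift :: "nat \<Rightarrow> slice_op \<Rightarrow> slice_op" where
  "shift m (Cup k a b) = Cup (m + k) a b"
| "shift m (Vtx k s) = Vtx (m + k) s"
| "shift m (Cap k a b) = Cap (m + k) a b"

text \<open>The final caps join the running pair to the far legs of the two initial nested cups, the
  inner pair first. Each sector leaves two boundary edges behind, hence
  \<open>m + 2\<close>.\<close>

fun sectors :: "nat \<Rightarrow> nat \<Rightarrow> slice_op list" where
  "sectors 0 m = [Cap (m + 1) Pl Mi, Cap m Pl Mi]"
| "sectors (Suc n) m = map (shift m) sector @ sectors n (m + 2)"

definition sweep :: "slice_op list" where
  "sweep = [Cup 0 Pl Mi, Cup 1 Pl Mi] @ sectors 6 0"

text \<open>\<open>apply_op\<close> does not depend on the sign labels; fixing them makes slice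
  words with different signs comparable.\<close>

definition cup where "cup k = apply_op (Cup k Pl Mi)"
definition vtx where "vtx k = apply_op (Vtx k Pl)"
definition cap where "cap k = apply_op (Cap k Pl Mi)"

lemma forget_signs: "apply_op (Cup k a b) = cup k" "apply_op (Vtx k s) = vtx k" "apply_op (Cap k a b) = cap k"
  by (simp_all add: cup_def vtx_def cap_def fun_eq_iff)

lemmas swaps = Cap_Vtx_swap Cap_Cap_swap Vtx_Vtx_swap Vtx_Cap_swap

text \<open>The given presentation builds the inner hexagon first, \<open>sweep\<close> proceeds in
  angular order. They differ by commutations of distant slices, so the swap rules identify
  them.\<close>

lemma web_w1_sweep: "web_w1 = eval_slices sweep"
  by (simp add: web_w1_def eval_slices_def w1_slices_def sweep_def sector_def eval_nat_numeral(2-3) forget_signs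
    swaps[unfolded forget_signs] del: apply_op.simps)

section \<open>Leading exponents\<close>

text \<open>A formal sum of terms \<open>v^e e_J\<close>, kept as a list so that repeated terms
  count with multiplicity.\<close>

definition of_terms :: "(int list \<times> int) list \<Rightarrow> vec" where
  "of_terms L = (\<lambda>J. \<Sum>(J', e)\<leftarrow>L. if J' = J then vv powi e else 0)"

text \<open>All nonzero coefficients of cups, vertices and caps are pure powers of \<open>v\<close>,
  so each slice replaces a term by a list of terms, and a web expands into one term per edge
  labelling.\<close>

fun step :: "slice_op \<Rightarrow> int list \<times> int \<Rightarrow> (int list \<times> int) list" where
  "step (Cup k a b) (J, e) = (if k \<le> length J
     then map (\<lambda>j. (take k J @ [j, - j] @ drop k J, e + (j - 1))) [1, 0, -1] else [])"
| "step (Vtx k s) (J, e) = (if k \<le> length J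
     then map (\<lambda>(I, d). (take k J @ I @ drop k J, e + d))
       [([1, 0, -1], 0), ([0, 1, -1], -1), ([1, -1, 0], -1), ([0, -1, 1], -2), ([-1, 1, 0], -2), ([-1, 0, 1], -3)]
     else [])"
| "step (Cap k a b) (J, e) = (if k + 2 \<le> length J \<and> J ! k \<in> {1, 0, -1} \<and> J ! (k + 1) = - (J ! k)
     then [(take k J @ drop (k + 2) J, e + (1 + J ! k))] else [])"

definition run :: "slice_op list \<Rightarrow> (int list \<times> int) list \<Rightarrow> (int list \<times> int) list" where
  "run us L = fold (\<lambda>u L. concat (map (step u) L)) us L"

lemma of_terms_Nil [simp]: "of_terms [] = vzero"
  by (simp add: of_terms_def vzero_def)

lemma of_terms_append: "of_terms (L @ M) = vadd (of_terms L) (of_terms M)"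
  by (simp add: of_terms_def vadd_def)

lemma apply_op_single: "apply_op u (of_terms [(J, e)]) = of_terms (step u (J, e))"
proof
  fix J' :: "int list"
  \<comment> \<open>\<open>apply_op\<close> reads a coefficient back from the target index,
    \<open>step\<close> pushes a basis vector forward; this equivalence translates insertion of a
    block \<open>I\<close> between the two views.\<close>
  have split: "(k + length I \<le> length J' \<and> take (length I) (drop k J') = I \<and> J = take k J' @ drop (k + length I) J') \<longleftrightarrow>
     (k \<le> length J \<and> take k J @ I @ drop k J = J')" for k and I :: "int list"
  proof
    assume *: "k + length I \<le> length J' \<and> take (length I) (drop k J') = I \<and> J = take k J' @ drop (k + length I) J'"
    then have "J' = take k J' @ I @ drop (k + length I) J'"
      by (metis append_take_drop_id add.commute drop_drop)
    with * show "k \<le> length J \<and> take k J @ I @ drop k J = J'" by auto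
  next
    assume "k \<le> length J \<and> take k J @ I @ drop k J = J'"
    then show "k + length I \<le> length J' \<and> take (length I) (drop k J') = I \<and> J = take k J' @ drop (k + length I) J'"
      by auto
  qed
  have take2: "take 2 (drop k J') = [J' ! k, J' ! (k + 1)]" if "k + 2 \<le> length J'" for k
    using that by (simp add: list_eq_iff_nth_eq less_2_cases_iff)
  have take3: "take 3 (drop k J') = [J' ! k, J' ! (k + 1), J' ! (k + 2)]" if "k + 3 \<le> length J'" for k
    using that by (auto simp: list_eq_iff_nth_eq eval_nat_numeral less_Suc_eq)
  show "apply_op u (of_terms [(J, e)]) J' = of_terms (step u (J, e)) J'"
  proof (cases u)
    case (Cup k a b)
    have cond: "k \<le> length J \<and> take k J @ [j, - j] @ drop k J = J' \<longleftrightarrow>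
      k + 2 \<le> length J' \<and> J' ! k = j \<and> J' ! (k + 1) = - j \<and> J = take k J' @ drop (k + 2) J'" for j
      using split[of k "[j, - j]"] take2[of k] by (auto simp: eval_nat_numeral simp del: append_eq_append_conv_if)
    have "of_terms (step u (J, e)) J' =
      (\<Sum>j\<leftarrow>[1, 0, -1]. if k \<le> length J \<and> take k J @ [j, - j] @ drop k J = J' then vv powi (e + (j - 1)) else 0)"
      by (simp add: Cup of_terms_def)
    also have "\<dots> = apply_op u (of_terms [(J, e)]) J'"
      unfolding cond
      by (auto simp: Cup of_terms_def cup_coef_def power_int_diff power2_eq_square field_simps)
    finally show ?thesis ..
  next
    case (Vtx k s)
    have cond: "k \<le> length J \<and> take k J @ [j, l, m] @ drop k J = J' \<longleftrightarrow>
      k + 3 \<le> length J' \<and> J' ! k = j \<and> J' ! (k + 1) = l \<and> J' ! (k + 2) = m \<and> J = take k J' @ drop (k + 3) J'" for j l m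
      using split[of k "[j, l, m]"] take3[of k] by (auto simp: eval_nat_numeral simp del: append_eq_append_conv_if)
    have "of_terms (step u (J, e)) J' =
      (\<Sum>(j, l, m, d)\<leftarrow>[(1, 0, -1, 0), (0, 1, -1, -1), (1, -1, 0, -1), (0, -1, 1, -2), (-1, 1, 0, -2), (-1, 0, 1, -3)].
         if k \<le> length J \<and> take k J @ [j, l, m] @ drop k J = J' then vv powi (e + d) else 0)"
      by (simp add: Vtx of_terms_def)
    also have "\<dots> = apply_op u (of_terms [(J, e)]) J'"
      unfolding cond
      by (auto simp: Vtx of_terms_def tri_coef_def power_int_diff power2_eq_square power3_eq_cube field_simps)
    finally show ?thesis ..
  next
    case (Cap k a b)
    show ?thesis
    proof (cases "k \<le> length J'")
      case False
      then show ?thesis by (auto simp: Cap of_terms_def)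
    next
      case True
      have cond: "J = take k J' @ [j, l] @ drop k J' \<longleftrightarrow>
        k + 2 \<le> length J \<and> J ! k = j \<and> J ! (k + 1) = l \<and> take k J @ drop (k + 2) J = J'" for j l
      proof
        assume "J = take k J' @ [j, l] @ drop k J'"
        then show "k + 2 \<le> length J \<and> J ! k = j \<and> J ! (k + 1) = l \<and> take k J @ drop (k + 2) J = J'"
          using True by (simp add: nth_append)
      next
        assume *: "k + 2 \<le> length J \<and> J ! k = j \<and> J ! (k + 1) = l \<and> take k J @ drop (k + 2) J = J'"
        then have "take 2 (drop k J) = [j, l]"
          by (auto simp: list_eq_iff_nth_eq less_2_cases_iff)
        then have "J = take k J @ [j, l] @ drop (k + 2) J"
          by (metis append_take_drop_id add.commute drop_drop)
        then show "J = take k J' @ [j, l] @ drop k J'"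
          using * by auto
      qed
      have "apply_op u (of_terms [(J, e)]) J' = (\<Sum>j\<in>{-1, 0, 1}. \<Sum>l\<in>{-1, 0, 1}.
          cap_coef j l * (if J = take k J' @ [j, l] @ drop k J' then vv powi e else 0))"
        using True by (simp add: Cap of_terms_def)
      also have "\<dots> = of_terms (step u (J, e)) J'"
        unfolding cond
        by (auto simp: Cap of_terms_def cap_coef_def power_int_add power2_eq_square)
      finally show ?thesis .
    qed
  qed
qed

lemma apply_op_of_terms: "apply_op u (of_terms L) = of_terms (concat (map (step u) L))"
proof (induction L)
  case Nil
  then show ?case using apply_op_vscale[of u 0 vzero] by (simp add: vec_defs)
next
  case (Cons x L)
  have "of_terms (x # L) = vadd (of_terms [x]) (of_terms L)"
    using of_terms_append[of "[x]" L] by simp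
  then show ?case
    using Cons.IH apply_op_single[of u "fst x" "snd x"] by (simp add: apply_op_vadd of_terms_append)
qed

lemma eval_slices_of_terms: "eval_slices us = of_terms (run us [([], 0)])"
proof -
  have "fold apply_op us (of_terms L) = of_terms (run us L)" for L
    by (induction us arbitrary: L) (simp_all add: run_def apply_op_of_terms)
  moreover have "(\<lambda>J. if J = [] then 1 else 0) = of_terms [([], 0)]"
    by (auto simp: of_terms_def)
  ultimately show ?thesis by (simp add: eval_slices_def)
qed

lemma run_Nil [simp]: "run us [] = []"
  by (induction us) (simp_all add: run_def)

lemma run_append: "run us (L @ M) = run us L @ run us M"
  by (induction us arbitrary: L M) (simp_all add: run_def)

lemma run_concat: "run us L = concat (map (\<lambda>x. run us [x]) L)"
proof (induction L)
  case (Cons x L)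
  then show ?case using run_append[of us "[x]" L] by simp
qed simp

lemma run_comp: "run (us @ ws) L = run ws (run us L)"
  by (simp add: run_def)

lemma run_Cons: "run (u # us) [x] = concat (map (\<lambda>y. run us [y]) (step u x))"
  using run_concat[of us "step u x"] by (simp add: run_def)

section \<open>Locality of slices and the transfer table of one sector\<close>

fun ok :: "slice_op list \<Rightarrow> nat \<Rightarrow> bool" where
  "ok [] n \<longleftrightarrow> True"
| "ok (Cup k a b # us) n \<longleftrightarrow> k \<le> n \<and> ok us (n + 2)"
| "ok (Vtx k s # us) n \<longleftrightarrow> k \<le> n \<and> ok us (n + 3)"
| "ok (Cap k a b # us) n \<longleftrightarrow> k + 2 \<le> n \<and> ok us (n - 2)"

definition frame :: "int list \<Rightarrow> int list \<Rightarrow> int \<Rightarrow> int list \<times> int \<Rightarrow> int list \<times> int" where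
  "frame P R d = (\<lambda>(W, e). (P @ W @ R, e + d))"

lemma step_shift:
  assumes "ok [u] (length W)"
  shows "step (shift (length P) u) (frame P R d (W, e)) = map (frame P R d) (step u (W, e))"
  using assms by (cases u) (auto simp: frame_def nth_append)

text \<open>\<open>ok\<close> keeps every slice inside the window \<open>W\<close>, so the strands
  \<open>P\<close> and \<open>R\<close> around it and the accumulated exponent \<open>d\<close> are
  carried along unchanged.\<close>

lemma run_shift:
  assumes "ok us (length W)"
  shows "run (map (shift (length P)) us) [frame P R d (W, e)] = map (frame P R d) (run us [(W, e)])"
  using assms
proof (induction us arbitrary: W e)
  case Nil
  show ?case by (simp add: run_def)
next
  case (Cons u us)
  have "ok [u] (length W)"
    using Cons.prems by (cases u) auto
  moreover have "ok us (length (fst y))" if "y \<in> set (step u (W, e))" for y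
    using that Cons.prems by (cases u) (auto simp: numeral_3_eq_3 split: if_splits)
  ultimately show ?case
    using Cons.IH by (simp add: run_Cons step_shift map_concat comp_def) (auto intro!: arg_cong[of _ _ concat])
qed

text \<open>An entry \<open>(p, q, \<rho>', c', d)\<close> records the two boundary labels, the next running pair and the exponent.\<close>
definition moves :: "int \<Rightarrow> int \<Rightarrow> (int \<times> int \<times> int \<times> int \<times> int) list" where
  "moves \<rho> c = (
   if \<rho> = 1 \<and> c = 1 then [(1, 1, 0, 0, 0), (1, 0, 1, 0, -1), (0, 1, 0, 1, -1), (0, 0, 1, 1, -2)]
   else if \<rho> = 1 \<and> c = 0 then [(1, 1, 0, -1, 0), (1, 0, 1, -1, -1), (1, 0, -1, 1, 0),
       (1, -1, 0, 1, -1), (0, 1, -1, 1, -1), (0, -1, 1, 1, -2)]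
   else if \<rho> = 1 \<and> c = -1 then [(1, 0, -1, 0, 0), (1, -1, 0, 0, -1), (0, 1, 0, -1, 0),
       (0, 0, 1, -1, -1), (0, 1, -1, 0, -1), (0, -1, 1, 0, -2)]
   else if \<rho> = 0 \<and> c = 1 then [(1, 1, -1, 0, 0), (1, -1, 1, 0, -1), (1, 0, -1, 1, -1),
       (1, -1, 0, 1, -2), (-1, 1, 0, 1, -1), (-1, 0, 1, 1, -2)]
   else if \<rho> = 0 \<and> c = 0 then [(1, 1, -1, -1, 0), (1, -1, 1, -1, -1), (-1, 1, -1, 1, -1),
       (-1, -1, 1, 1, -2)]
   else if \<rho> = 0 \<and> c = -1 then [(1, 0, -1, -1, 0), (1, -1, 0, -1, -1), (-1, 1, 0, -1, 0),
       (-1, 0, 1, -1, -1), (-1, 1, -1, 0, -1), (-1, -1, 1, 0, -2)]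
   else if \<rho> = -1 \<and> c = 1 then [(0, 1, -1, 0, 0), (0, -1, 1, 0, -1), (0, 0, -1, 1, -1),
       (0, -1, 0, 1, -2), (-1, 1, 0, 0, -1), (-1, 0, 1, 0, -2)]
   else if \<rho> = -1 \<and> c = 0 then [(0, 1, -1, -1, 0), (0, -1, 1, -1, -1), (-1, 1, 0, -1, -1),
       (-1, 0, 1, -1, -2), (-1, 0, -1, 1, -1), (-1, -1, 0, 1, -2)]
   else if \<rho> = -1 \<and> c = -1 then [(0, 0, -1, -1, 0), (0, -1, 0, -1, -1), (-1, 0, -1, 0, -1),
       (-1, -1, 0, 0, -2)]
   else [])"

text \<open>A finite computation for the nine states. Both sides are lists, so \<open>moves\<close>
  keeps the order in which \<open>run\<close> produces the terms.\<close>

lemma run_sector_0: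
  assumes "\<rho> \<in> {1, 0, -1}" "c \<in> {1, 0, -1}"
  shows "run sector [([\<rho>, c], 0)] = map (\<lambda>(p, q, \<rho>', c', d). ([p, q, \<rho>', c'], d)) (moves \<rho> c)"
  using assms
  by (auto simp: run_def sector_def moves_def eval_nat_numeral)

lemma run_sector:
  assumes "\<rho> \<in> {1, 0, -1}" "c \<in> {1, 0, -1}"
  shows "run (map (shift (length P)) sector) [(P @ \<rho> # c # R, e)] =
    map (\<lambda>(p, q, \<rho>', c', d). (P @ p # q # \<rho>' # c' # R, e + d)) (moves \<rho> c)"
proof -
  have "ok sector (length [\<rho>, c])" by (simp add: sector_def)
  from run_shift[OF this, of P R e 0] run_sector_0[OF assms] show ?thesis
    by (simp add: frame_def comp_def case_prod_unfold add.commute)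
qed

lemma moves_range:
  "(p, q, \<rho>', c', d) \<in> set (moves \<rho> c) \<Longrightarrow> \<rho>' \<in> {1, 0, -1} \<and> c' \<in> {1, 0, -1}"
  by (auto simp: moves_def split: if_splits)

lemma run_sectors_0:
  assumes "\<rho> \<in> {1, 0, -1}" "c \<in> {1, 0, -1}"
  shows "run (sectors 0 (length P)) [(P @ [\<rho>, c, - c0, - \<rho>0], e)] =
    (if \<rho> = \<rho>0 \<and> c = c0 then [(P, e + (2 + \<rho>0 + c0))] else [])"
  using assms by (auto simp: run_def nth_append)

lemma run_sectors_Suc:
  assumes "\<rho> \<in> {1, 0, -1}" "c \<in> {1, 0, -1}"
  shows "run (sectors (Suc n) (length P)) [(P @ \<rho> # c # R, e)] =
    concat (map (\<lambda>(p, q, \<rho>', c', d). run (sectors n (length (P @ [p, q]))) [((P @ [p, q]) @ \<rho>' # c' # R, e + d)])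
      (moves \<rho> c))"
  by (simp only: sectors.simps run_comp run_sector[OF assms])
    (simp add: run_concat[of "sectors n (Suc (Suc (length P)))" "map _ _"] comp_def case_prod_unfold)

section \<open>Max-plus bounds and the pruned search\<close>

definition states :: "(int \<times> int) list" where
  "states = [(1, 1), (1, 0), (1, -1), (0, 1), (0, 0), (0, -1), (-1, 1), (-1, 0), (-1, -1)]"

text \<open>The position of a state in the list \<open>states\<close>.\<close>

definition idx :: "int \<Rightarrow> int \<Rightarrow> nat" where "idx \<rho> c = nat (4 - 3 * \<rho> - c)"

text \<open>One entry of a max-plus matrix-vector product, with \<open>-9\<close> in place of minus
  infinity.\<close>

fun best :: "int list \<Rightarrow> (int \<times> int \<times> int \<times> int \<times> int) list \<Rightarrow> int" where
  "best row [] = -9"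
| "best row ((p, q, \<rho>, c, d) # ms) = max (d + row ! idx \<rho> c) (best row ms)"

text \<open>\<open>max_exp \<rho>0 c0 n\<close> lists, by state, the largest exponent that the last \<open>n\<close> sectors of a labelling with initial
  state \<open>(\<rho>0, c0)\<close> can contribute (\<open>-9\<close> is a harmless bound where there is no such labelling).\<close>
fun max_exp :: "int \<Rightarrow> int \<Rightarrow> nat \<Rightarrow> int list" where
  "max_exp \<rho>0 c0 0 = map (\<lambda>(\<rho>, c). if \<rho> = \<rho>0 \<and> c = c0 then 2 + \<rho>0 + c0 else -9) states"
| "max_exp \<rho>0 c0 (Suc n) = map (\<lambda>(\<rho>, c). best (max_exp \<rho>0 c0 n) (moves \<rho> c)) states"

lemma map_states_nth:
  "\<rho> \<in> {1, 0, -1} \<Longrightarrow> c \<in> {1, 0, -1} \<Longrightarrow> map f states ! idx \<rho> c = f (\<rho>, c)"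
  by (auto simp: states_def idx_def)

lemma best_ge: "(p, q, \<rho>, c, d) \<in> set ms \<Longrightarrow> d + row ! idx \<rho> c \<le> best row ms"
  by (induction ms) auto

text \<open>Split off the first move: its exponent plus the bound for the remaining sectors is one
  of the terms maximised by \<open>best\<close>.\<close>

lemma run_sectors_le:
  assumes "\<rho> \<in> {1, 0, -1}" "c \<in> {1, 0, -1}"
    and "x \<in> set (run (sectors n (length P)) [(P @ [\<rho>, c, - c0, - \<rho>0], e)])"
  shows "snd x \<le> e + max_exp \<rho>0 c0 n ! idx \<rho> c"
  using assms
proof (induction n arbitrary: P \<rho> c e)
  case 0
  then show ?case
    by (simp add: run_sectors_0 map_states_nth split: if_splits del: sectors.simps)
next
  case (Suc n)
  from Suc.prems(3) obtain p q \<rho>' c' d where m: "(p, q, \<rho>', c', d) \<in> set (moves \<rho> c)"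
    and x: "x \<in> set (run (sectors n (length (P @ [p, q]))) [((P @ [p, q]) @ [\<rho>', c', - c0, - \<rho>0], e + d)])"
    unfolding run_sectors_Suc[OF Suc.prems(1,2)] by auto
  have "snd x \<le> e + d + max_exp \<rho>0 c0 n ! idx \<rho>' c'"
    using moves_range[OF m] by (intro Suc.IH[OF _ _ x]) auto
  moreover have "d + max_exp \<rho>0 c0 n ! idx \<rho>' c' \<le> max_exp \<rho>0 c0 (Suc n) ! idx \<rho> c"
    using best_ge[OF m] by (simp only: max_exp.simps map_states_nth[OF Suc.prems(1,2)] prod.case)
  ultimately show ?case by simp
qed

definition nonneg :: "(int list \<times> int) list \<Rightarrow> (int list \<times> int) list" where
  "nonneg = filter (\<lambda>x. 0 \<le> snd x)"

text \<open>The bound is consulted after a move, so the list for \<open>n\<close> sectors starts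
  with \<open>max_exp\<close> at \<open>n - 1\<close>. Passing it to the search as data avoids
  recomputing it in every branch.\<close>

fun rows :: "int \<Rightarrow> int \<Rightarrow> nat \<Rightarrow> int list list" where
  "rows \<rho>0 c0 0 = []"
| "rows \<rho>0 c0 (Suc n) = max_exp \<rho>0 c0 n # rows \<rho>0 c0 n"

text \<open>The continuation \<open>f\<close> stands for the search over the remaining rows, which
  turns the recursion over moves and that over sectors into two structural ones.\<close>

fun expand :: "(int list \<Rightarrow> int \<Rightarrow> int \<Rightarrow> int \<Rightarrow> 'a list) \<Rightarrow> int list \<Rightarrow> int list \<Rightarrow> int \<Rightarrow>
    (int \<times> int \<times> int \<times> int \<times> int) list \<Rightarrow> 'a list" where
  "expand f row P e [] = []"
| "expand f row P e ((p, q, \<rho>, c, d) # ms) =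
     (if 0 \<le> e + d + row ! idx \<rho> c then f (P @ [p, q]) \<rho> c (e + d) else []) @ expand f row P e ms"

text \<open>The terms of nonnegative exponent, by a search that cuts every branch excluded by \<open>max_exp\<close>.\<close>
fun search :: "int \<Rightarrow> int \<Rightarrow> int list list \<Rightarrow> int list \<Rightarrow> int \<Rightarrow> int \<Rightarrow> int \<Rightarrow> (int list \<times> int) list" where
  "search \<rho>0 c0 [] P \<rho> c e =
     (if \<rho> = \<rho>0 \<and> c = c0 \<and> 0 \<le> e + (2 + \<rho>0 + c0) then [(P, e + (2 + \<rho>0 + c0))] else [])"
| "search \<rho>0 c0 (row # rs) P \<rho> c e = expand (search \<rho>0 c0 rs) row P e (moves \<rho> c)"

lemma nonneg_run_sectors:
  assumes "\<rho> \<in> {1, 0, -1}" "c \<in> {1, 0, -1}"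
  shows "nonneg (run (sectors n (length P)) [(P @ [\<rho>, c, - c0, - \<rho>0], e)]) = search \<rho>0 c0 (rows \<rho>0 c0 n) P \<rho> c e"
  using assms
proof (induction n arbitrary: P \<rho> c e)
  case 0
  then show ?case
    by (simp add: run_sectors_0 nonneg_def del: sectors.simps)
next
  case (Suc n)
  have cut: "nonneg (run (sectors n (length (P @ [p, q]))) [((P @ [p, q]) @ [\<rho>', c', - c0, - \<rho>0], e + d)]) =
    (if 0 \<le> e + d + max_exp \<rho>0 c0 n ! idx \<rho>' c' then search \<rho>0 c0 (rows \<rho>0 c0 n) (P @ [p, q]) \<rho>' c' (e + d) else [])"
    if "(p, q, \<rho>', c', d) \<in> set (moves \<rho> c)" for p q \<rho>' c' d
  proof (cases "0 \<le> e + d + max_exp \<rho>0 c0 n ! idx \<rho>' c'")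
    case True
    then show ?thesis using moves_range[OF that] Suc.IH[of \<rho>' c' "P @ [p, q]" "e + d"] by simp
  next
    case False
    \<comment> \<open>The discarded branch contains only negative exponents, so cutting it is
      exact.\<close>
    then have "\<not> 0 \<le> snd x"
      if "x \<in> set (run (sectors n (length (P @ [p, q]))) [((P @ [p, q]) @ [\<rho>', c', - c0, - \<rho>0], e + d)])" for x
      using run_sectors_le[OF _ _ that] moves_range[OF \<open>(p, q, \<rho>', c', d) \<in> set (moves \<rho> c)\<close>] by force
    then show ?thesis
      using False by (auto simp: nonneg_def filter_empty_conv)
  qed
  \<comment> \<open>Generalised from \<open>moves \<rho> c\<close> to any list of its entries, for
    induction over the list.\<close>
  have "nonneg (concat (map (\<lambda>(p, q, \<rho>', c', d).
      run (sectors n (length (P @ [p, q]))) [((P @ [p, q]) @ \<rho>' # c' # [- c0, - \<rho>0], e + d)]) ms)) =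
    expand (search \<rho>0 c0 (rows \<rho>0 c0 n)) (max_exp \<rho>0 c0 n) P e ms" if "set ms \<subseteq> set (moves \<rho> c)" for ms
    using that
  proof (induction ms)
    case Nil
    show ?case by (simp add: nonneg_def)
  next
    case (Cons m ms)
    obtain p q \<rho>' c' d where m: "m = (p, q, \<rho>', c', d)" by (cases m)
    have append: "nonneg (L @ M) = nonneg L @ nonneg M" for L M
      by (simp add: nonneg_def)
    show ?case
      unfolding m list.map concat.simps append prod.case expand.simps
      using cut[of p q \<rho>' c' d] Cons by (simp add: m)
  qed
  then show ?case
    unfolding run_sectors_Suc[OF Suc.prems] by simp
qed

text \<open>\<open>J_lead\<close> will index the dual canonical element. \<open>J_arcs\<close> puts
  \<open>1\<close> at the left and \<open>-1\<close> at the right end of each of the six arcs, where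
  every cup has exponent 0.\<close>

definition J_lead :: "int list" where "J_lead = [1, 1, 1, 1, 0, 0, 0, 0, -1, -1, -1, -1]"
definition J_arcs :: "int list" where "J_arcs = [1, 1, -1, 1, -1, 1, -1, 1, -1, 1, -1, -1]"

text \<open>The initial cups open the sweep in each of the nine states with exponent
  \<open>(\<rho> - 1) + (c - 1)\<close>, and the sweep has to return to that state.\<close>

lemma nonneg_run_sweep:
  "nonneg (run sweep [([], 0)]) = concat (map (\<lambda>(\<rho>, c). search \<rho> c (rows \<rho> c 6) [] \<rho> c (\<rho> + c - 2)) states)"
proof -
  have "run [Cup 0 Pl Mi, Cup 1 Pl Mi] [([], 0)] = map (\<lambda>(\<rho>, c). ([\<rho>, c, - c, - \<rho>], \<rho> + c - 2)) states"
    by (simp add: run_def states_def)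
  then have "run sweep [([], 0)] = concat (map (\<lambda>(\<rho>, c). run (sectors 6 (length ([] :: int list))) [([] @ [\<rho>, c, - c, - \<rho>], \<rho> + c - 2)]) states)"
    unfolding sweep_def run_comp by (subst run_concat) (simp add: comp_def case_prod_unfold)
  then have "nonneg (run sweep [([], 0)]) =
     concat (map (\<lambda>(\<rho>, c). nonneg (run (sectors 6 (length ([] :: int list))) [([] @ [\<rho>, c, - c, - \<rho>], \<rho> + c - 2)])) states)"
    by (simp only: nonneg_def filter_concat map_map comp_def case_prod_unfold)
  also have "\<dots> = concat (map (\<lambda>(\<rho>, c). search \<rho> c (rows \<rho> c 6) [] \<rho> c (\<rho> + c - 2)) states)"
    by (intro arg_cong[of _ _ concat] map_cong refl, clarify, intro nonneg_run_sectors) (auto simp: states_def)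
  finally show ?thesis .
qed

section \<open>Evaluation of the bounds and of the search\<close>

definition next_row :: "int list \<Rightarrow> int list" where
  "next_row row = map (\<lambda>(\<rho>, c). best row (moves \<rho> c)) states"

lemma max_exp_Suc: "max_exp \<rho>0 c0 (Suc n) = next_row (max_exp \<rho>0 c0 n)"
  by (simp add: next_row_def)

lemma moves_eval:
  "moves 1 1 = [(1, 1, 0, 0, 0), (1, 0, 1, 0, -1), (0, 1, 0, 1, -1), (0, 0, 1, 1, -2)]"
  "moves 1 0 = [(1, 1, 0, -1, 0), (1, 0, 1, -1, -1), (1, 0, -1, 1, 0),
     (1, -1, 0, 1, -1), (0, 1, -1, 1, -1), (0, -1, 1, 1, -2)]"
  "moves 1 (-1) = [(1, 0, -1, 0, 0), (1, -1, 0, 0, -1), (0, 1, 0, -1, 0),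
     (0, 0, 1, -1, -1), (0, 1, -1, 0, -1), (0, -1, 1, 0, -2)]"
  "moves 0 1 = [(1, 1, -1, 0, 0), (1, -1, 1, 0, -1), (1, 0, -1, 1, -1),
     (1, -1, 0, 1, -2), (-1, 1, 0, 1, -1), (-1, 0, 1, 1, -2)]"
  "moves 0 0 = [(1, 1, -1, -1, 0), (1, -1, 1, -1, -1), (-1, 1, -1, 1, -1), (-1, -1, 1, 1, -2)]"
  "moves 0 (-1) = [(1, 0, -1, -1, 0), (1, -1, 0, -1, -1), (-1, 1, 0, -1, 0),
     (-1, 0, 1, -1, -1), (-1, 1, -1, 0, -1), (-1, -1, 1, 0, -2)]"
  "moves (-1) 1 = [(0, 1, -1, 0, 0), (0, -1, 1, 0, -1), (0, 0, -1, 1, -1),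
     (0, -1, 0, 1, -2), (-1, 1, 0, 0, -1), (-1, 0, 1, 0, -2)]"
  "moves (-1) 0 = [(0, 1, -1, -1, 0), (0, -1, 1, -1, -1), (-1, 1, 0, -1, -1),
     (-1, 0, 1, -1, -2), (-1, 0, -1, 1, -1), (-1, -1, 0, 1, -2)]"
  "moves (-1) (-1) = [(0, 0, -1, -1, 0), (0, -1, 0, -1, -1), (-1, 0, -1, 0, -1), (-1, -1, 0, 0, -2)]"
  by (simp_all add: moves_def)

text \<open>\<open>next_row\<close> on nine symbolic entries: moves and indices are resolved once,
  so that later rows are only maxima of integers.\<close>

lemmas next_row_eval = next_row_def[of "[a1, a2, a3, a4, a5, a6, a7, a8, a9]" for a1 a2 a3 a4 a5 a6 a7 a8 a9,
    unfolded states_def list.map prod.case moves_eval, simplified best.simps idx_def, simplified]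

lemma rows_eval:
  "rows 1 1 6 = [[0, 0, 0, 0, 0, 0, 0, 0, 0], [0, 0, 0, 0, 0, 0, 0, 0, 0],
    [0, 1, 0, 0, 0, 0, 0, 0, 0], [2, 1, 1, 1, 0, 0, 1, 0, 0],
    [2, 2, -9, 2, 2, -9, -9, -9, -9], [4, -9, -9, -9, -9, -9, -9, -9, -9]]"
  "rows 1 0 6 = [[0, 1, 1, 0, 0, 1, 0, 0, 0], [0, 1, 1, 0, 0, 1, 0, 0, 0],
    [1, 1, 1, 1, 0, 1, 1, 0, 0], [1, 2, 1, 1, 1, 1, 1, 1, 0],
    [2, -9, 1, 2, -9, 1, 2, -9, -9], [-9, 3, -9, -9, -9, -9, -9, -9, -9]]"
  "rows 1 (-1) 6 = [[0, 1, 1, 0, 0, 1, 0, 0, 0], [0, 1, 1, 0, 0, 1, 0, 0, 0],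
    [0, 1, 1, 0, 0, 1, 0, 0, 0], [1, 1, 1, 1, 0, 1, 1, 0, 0],
    [-9, 1, 1, -9, 1, 1, -9, 1, -9], [-9, -9, 2, -9, -9, -9, -9, -9, -9]]"
  "rows 0 1 6 = [[0, 0, 0, 0, 0, 0, 0, 0, 0], [0, 0, 0, 0, 0, 0, 0, 0, 0],
    [0, 1, 0, 0, 0, 0, 0, 0, 0], [1, 1, 1, 1, 0, 0, 1, 0, 0],
    [2, 2, -9, 2, -9, -9, 1, 1, -9], [-9, -9, -9, 3, -9, -9, -9, -9, -9]]"
  "rows 0 0 6 = [[0, 0, 0, 0, 0, 0, 0, 0, 0], [0, 0, 0, 0, 0, 0, 0, 0, 0],
    [0, 0, 0, 0, 0, 0, 0, 0, 0], [0, 1, 0, 0, 0, 0, 0, 0, 0],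
    [2, -9, 1, -9, -9, -9, 1, -9, 0], [-9, -9, -9, -9, 2, -9, -9, -9, -9]]"
  "rows 0 (-1) 6 = [[0, 1, 1, 0, 0, 1, 0, 0, 0], [0, 1, 1, 0, 0, 1, 0, 0, 0],
    [0, 1, 1, 0, 0, 1, 0, 0, 0], [0, 1, 1, 0, 0, 1, 0, 0, 0],
    [-9, 1, 1, -9, -9, 1, -9, 0, 0], [-9, -9, -9, -9, -9, 1, -9, -9, -9]]"
  "rows (-1) 1 6 = [[0, 0, 0, 0, 0, 0, 0, 0, 0], [0, 0, 0, 0, 0, 0, 0, 0, 0],
    [0, 1, 0, 0, 0, 0, 0, 0, 0], [1, 1, 1, 1, 0, 0, 1, 0, 0],
    [-9, 2, -9, 1, 1, -9, 1, 1, -9], [-9, -9, -9, -9, -9, -9, 2, -9, -9]]"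
  "rows (-1) 0 6 = [[0, 0, 0, 0, 0, 0, 0, 0, 0], [0, 0, 0, 0, 0, 0, 0, 0, 0],
    [0, 0, 0, 0, 0, 0, 0, 0, 0], [0, 1, 0, 0, 0, 0, 0, 0, 0],
    [-9, -9, 1, 1, -9, 0, 1, -9, 0], [-9, -9, -9, -9, -9, -9, -9, 1, -9]]"
  "rows (-1) (-1) 6 = [[0, 0, 0, 0, 0, 0, 0, 0, 0], [0, 0, 0, 0, 0, 0, 0, 0, 0],
    [0, 0, 0, 0, 0, 0, 0, 0, 0], [0, 0, 0, 0, 0, 0, 0, 0, 0],
    [-9, -9, -9, -9, 0, 0, -9, 0, 0], [-9, -9, -9, -9, -9, -9, -9, -9, 0]]"
  by (simp_all add: eval_nat_numeral max_exp_Suc next_row_eval states_def del: max_exp.simps(2))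

text \<open>Only the initial states \<open>(1, 1)\<close> and \<open>(1, 0)\<close> admit a
  labelling of nonnegative exponent, one each, and the exponent is then exactly 0.\<close>

lemma search_eval:
  "search 1 1 (rows 1 1 6) [] 1 1 0 = [(J_lead, 0)]"
  "search 1 0 (rows 1 0 6) [] 1 0 (-1) = [(J_arcs, 0)]"
  "search 1 (-1) (rows 1 (-1) 6) [] 1 (-1) (-2) = []"
  "search 0 1 (rows 0 1 6) [] 0 1 (-1) = []"
  "search 0 0 (rows 0 0 6) [] 0 0 (-2) = []"
  "search 0 (-1) (rows 0 (-1) 6) [] 0 (-1) (-3) = []"
  "search (-1) 1 (rows (-1) 1 6) [] (-1) 1 (-2) = []"
  "search (-1) 0 (rows (-1) 0 6) [] (-1) 0 (-3) = []"
  "search (-1) (-1) (rows (-1) (-1) 6) [] (-1) (-1) (-4) = []"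
  unfolding rows_eval J_lead_def J_arcs_def
  by (simp_all add: moves_eval idx_def)

lemma nonneg_run_sweep_eq: "nonneg (run sweep [([], 0)]) = [(J_lead, 0), (J_arcs, 0)]"
  unfolding nonneg_run_sweep states_def
  by (simp add: search_eval del: rows.simps search.simps)

section \<open>Leading coefficients of the two webs\<close>

fun is_cup :: "slice_op \<Rightarrow> bool" where
  "is_cup (Cup k a b) \<longleftrightarrow> True" | "is_cup _ \<longleftrightarrow> False"

text \<open>Cups never raise an exponent, so negative terms may be dropped after each slice; for
  \<open>w2_slices\<close> this avoids listing \<open>3^6\<close> terms.\<close>

lemma nonneg_run_cups:
  "list_all is_cup us \<Longrightarrow> nonneg (run us L) = fold (\<lambda>u L. nonneg (concat (map (step u) L))) us (nonneg L)"
proof (induction us arbitrary: L)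
  case Nil
  show ?case by (simp add: run_def)
next
  case (Cons u us)
  then obtain k a b where u: "u = Cup k a b" by (cases u) auto
  have append: "nonneg (L @ M) = nonneg L @ nonneg M" for L M
    by (simp add: nonneg_def)
  have "nonneg (concat (map (step u) L)) = nonneg (concat (map (step u) (nonneg L)))"
  proof (induction L)
    case Nil
    show ?case by (simp add: nonneg_def)
  next
    case (Cons x L)
    obtain J e where x: "x = (J, e)" by (cases x)
    have "nonneg (step u x) = []" if "e < 0"
      using that by (simp add: u x nonneg_def)
    then show ?case
      using Cons.IH by (cases "e < 0") (auto simp: append x nonneg_def)
  qed
  then show ?case
    using Cons.IH[of "concat (map (step u) L)"] Cons.prems by (simp add: run_def)
qed

lemma nonneg_run_w2: "nonneg (run w2_slices [([], 0)]) = [(J_arcs, 0)]"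
  by (subst nonneg_run_cups) (simp_all add: w2_slices_def nonneg_def J_arcs_def)

text \<open>Every discarded term contributes a negative power of \<open>v\<close>, and the lattice
  is closed under addition.\<close>

lemma of_terms_lattice:
  "of_terms L J - of_terms (nonneg L) J \<in> vinv_lattice"
proof (induction L)
  case Nil
  show ?case by (simp add: nonneg_def vinv_lattice_0)
next
  case (Cons x L)
  obtain J' e where x: "x = (J', e)" by (cases x)
  have "of_terms (x # L) J - of_terms (nonneg (x # L)) J =
     (if J' = J \<and> e < 0 then vv powi e else 0) + (of_terms L J - of_terms (nonneg L) J)"
    by (auto simp: of_terms_def nonneg_def x)
  then show ?case
    using Cons.IH by (simp add: vinv_lattice_add vinv_lattice_0 vinv_lattice_powi)
qed

lemma of_terms_single: "of_terms [(I, 0)] J = basis_vec I J"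
  by (simp add: of_terms_def basis_vec_def eq_commute)

lemma web_w1_coeffs: "web_w1 J - (basis_vec J_lead J + basis_vec J_arcs J) \<in> vinv_lattice"
proof -
  have "of_terms [(J_lead, 0), (J_arcs, 0)] J = basis_vec J_lead J + basis_vec J_arcs J"
    using of_terms_append[of "[(J_lead, 0)]" "[(J_arcs, 0)]"] by (simp add: of_terms_single vadd_def)
  then show ?thesis
    using of_terms_lattice[of "run sweep [([], 0)]" J]
    by (simp add: web_w1_sweep eval_slices_of_terms nonneg_run_sweep_eq)
qed

lemma web_w2_coeffs: "web_w2 J - basis_vec J_arcs J \<in> vinv_lattice"
  using of_terms_lattice[of "run w2_slices [([], 0)]" J]
  by (simp add: web_w2_def eval_slices_of_terms nonneg_run_w2 of_terms_single)

theorem theorem10: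
  shows "dual_canonical S12 (\<lambda>J. web_w1 J - web_w2 J)"
proof -
  define y where "y = (\<lambda>J. web_w1 J - web_w2 J)"
  have y: "y = vadd web_w1 (vscale (-1) web_w2)"
    by (simp add: y_def vec_defs)
  have "dual_can_elt S12 J_lead = y"
  proof (rule dual_can_elt_eqI)
    show "supp S12 y"
      unfolding y using web_w1_phi_fixed web_w2_phi_fixed by simp
    show "phi S12 y = y"
      unfolding y phi_vadd phi_vscale using web_w1_phi_fixed web_w2_phi_fixed by (simp add: barK_uminus)
    fix J
    \<comment> \<open>The two contributions of \<open>J_arcs\<close> cancel in the difference,
      leaving \<open>J_lead\<close> as the only leading term.\<close>
    show "y J - basis_vec J_lead J \<in> vinv_lattice"
      using vinv_lattice_diff[OF web_w1_coeffs[of J] web_w2_coeffs[of J]] by (simp add: y_def algebra_simps)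
  qed
  moreover have "valid S12 J_lead"
    by (simp add: S12_def J_lead_def)
  ultimately have "dual_canonical S12 y"
    unfolding dual_canonical_def by (intro exI[of _ J_lead] conjI) simp_all
  then show ?thesis by (simp only: y_def)
qed

end
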